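(* Let $X$ be a Banach space and let $\Gamma:[0,1]\to cwk(X)$ be any variationally Henstock integrable multifunction. Then $\mathcal{S}_{vH}(\Gamma)\neq\emptyset$ (that is, $\Gamma$ has a variationally Henstock integrable selection), and every strongly measurable selection of $\Gamma$ is variationally Henstock integrable.
   Context: $X$ is an arbitrary (not necessarily separable) real Banach space and $cwk(X)$ is the family of all non-empty convex weakly compact subsets of $X$, with Minkowski addition, multiplication by positive scalars, and the Hausdorff distance $d_H$. A multifunction is a map $\Gamma:[0,1]\to cwk(X)$; a selection of $\Gamma$ is a function $f:[0,1]\to X$ with $f(t)\in\Gamma(t)$ for every $t\in[0,1]$. $[0,1]$ carries Lebesgue measure; $\mathcal{I}$ is the collection of closed subintervals of $[0,1]$ and $|I|$ is the length of $I$. A gauge is any strictly positive function $\delta$ on $[0,1]$. A Perron partition of $[0,1]$ is a finite collection $\{(I_1,t_1),\dots,(I_p,t_p)\}$ of nonoverlapping intervals $I_j\in\mathcal{I}$ with union $[0,1]$ and points $t_j\in I_j$; it is $\delta$-fine if $I_j\subset(t_j-\delta(t_j),t_j+\delta(t_j))$ for all $j$. An interval multimeasure is a map $\Phi:\mathcal{I}\to cwk(X)$ with $\Phi(I_1\cup I_2)=\Phi(I_1)+\Phi(I_2)$ for all nonoverlapping $I_1,I_2\in\mathcal{I}$ with $I_1\cup I_2\in\mathcal{I}$. $\Gamma$ is variationally Henstock integrable if there is an interval multimeasure $\Phi_\Gamma:\mathcal{I}\to cwk(X)$ such that for every $\varepsilon>0$ there is a gauge $\delta$ on $[0,1]$ with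 $\sum_{j=1}^p d_H(\Phi_\Gamma(I_j),\Gamma(t_j)|I_j|)<\varepsilon$ for every $\delta$-fine Perron partition $\{(I_1,t_1),\dots,(I_p,t_p)\}$ of $[0,1]$. A function $f:[0,1]\to X$ is variationally Henstock integrable if the same holds with an additive $X$-valued interval function and the norm distance (equivalently, for $t\mapsto\{f(t)\}$). $\mathcal{S}_{vH}(\Gamma)$ is the set of variationally Henstock integrable selections of $\Gamma$. A function is strongly measurable if it is an a.e. limit in norm of a sequence of measurable simple functions. *)

theory Defs
  imports "HOL-Analysis.Analysis" "HOL-Library.Set_Algebras"
begin

text \<open>
  Functions on \<open>[0,1]\<close> are total functions on the reals of which only the values on \<open>{0..1}\<close> are
  used. Sums of sets are Minkowski sums, as in \<^theory>\<open>HOL-Library.Set_Algebras\<close>.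
\<close>

definition weak_topology :: "'a::real_normed_vector topology" where
  "weak_topology =
     topology_generated_by {\<phi> -` U |\<phi> U. bounded_linear (\<phi> :: 'a \<Rightarrow> real) \<and> open U}"

definition cwk :: "'a::real_normed_vector set set" where
  "cwk = {C. C \<noteq> {} \<and> convex C \<and> compactin weak_topology C}"

text \<open>
  The suprema are suprema of reals, so this is the Hausdorff distance on non-empty bounded sets
  only; members of \<^const>\<open>cwk\<close> are bounded by the uniform boundedness principle.
\<close>

definition hausdorff_dist :: "'a::metric_space set \<Rightarrow> 'a set \<Rightarrow> real" where
  "hausdorff_dist A B = max (SUP a\<in>A. infdist a B) (SUP b\<in>B. infdist b A)"

text \<open>
  One-point intervals are included, as they are in the library's tagged divisions. This is
  harmless: a one-point interval \<open>J\<close> does not overlap itself, so additivity gives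
  \<open>\<Phi> J = \<Phi> J + \<Phi> J\<close> and hence \<open>\<Phi> J = {0}\<close>, and such intervals contribute nothing to the sums below.
\<close>

definition subintervals :: "real set set" where
  "subintervals = {{a..b} |a b. 0 \<le> a \<and> a \<le> b \<and> b \<le> 1}"

definition additive_interval_function :: "(real set \<Rightarrow> 'b::plus) \<Rightarrow> bool" where
  "additive_interval_function \<Phi> \<longleftrightarrow>
     (\<forall>I\<in>subintervals. \<forall>J\<in>subintervals.
        interior I \<inter> interior J = {} \<longrightarrow> I \<union> J \<in> subintervals \<longrightarrow> \<Phi> (I \<union> J) = \<Phi> I + \<Phi> J)"

definition interval_multimeasure :: "(real set \<Rightarrow> 'a::real_normed_vector set) \<Rightarrow> bool" where
  "interval_multimeasure \<Phi> \<longleftrightarrow> (\<forall>I\<in>subintervals. \<Phi> I \<in> cwk) \<and> additive_interval_function \<Phi>"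

text \<open>A Perron partition is a tagged division of \<open>{0..1}\<close>; the library lists the tag first.\<close>

definition fine_perron_partition :: "(real \<Rightarrow> real) \<Rightarrow> (real \<times> real set) set \<Rightarrow> bool" where
  "fine_perron_partition \<delta> p \<longleftrightarrow>
     p tagged_division_of {0..1} \<and> (\<lambda>t. {t - \<delta> t <..< t + \<delta> t}) fine p"

definition vH_integrable_multi :: "(real \<Rightarrow> 'a::real_normed_vector set) \<Rightarrow> bool" where
  "vH_integrable_multi \<Gamma> \<longleftrightarrow>
     (\<exists>\<Phi>. interval_multimeasure \<Phi> \<and>
       (\<forall>\<epsilon>>0. \<exists>\<delta>. (\<forall>t\<in>{0..1}. \<delta> t > 0) \<and>
         (\<forall>p. fine_perron_partition \<delta> p \<longrightarrow>
            (\<Sum>(t, I)\<in>p. hausdorff_dist (\<Phi> I) ((\<lambda>x. measure lborel I *\<^sub>R x) ` \<Gamma> t)) < \<epsilon>)))"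

definition vH_integrable :: "(real \<Rightarrow> 'a::real_normed_vector) \<Rightarrow> bool" where
  "vH_integrable f \<longleftrightarrow>
     (\<exists>F. additive_interval_function F \<and>
       (\<forall>\<epsilon>>0. \<exists>\<delta>. (\<forall>t\<in>{0..1}. \<delta> t > 0) \<and>
         (\<forall>p. fine_perron_partition \<delta> p \<longrightarrow>
            (\<Sum>(t, I)\<in>p. norm (F I - measure lborel I *\<^sub>R f t)) < \<epsilon>)))"

definition selections :: "(real \<Rightarrow> 'a set) \<Rightarrow> (real \<Rightarrow> 'a) set" where
  "selections \<Gamma> = {f. \<forall>t\<in>{0..1}. f t \<in> \<Gamma> t}"

definition S_vH :: "(real \<Rightarrow> 'a::real_normed_vector set) \<Rightarrow> (real \<Rightarrow> 'a) set" where
  "S_vH \<Gamma> = {f \<in> selections \<Gamma>. vH_integrable f}"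

definition strongly_measurable :: "(real \<Rightarrow> 'a::real_normed_vector) \<Rightarrow> bool" where
  "strongly_measurable f \<longleftrightarrow>
     (\<exists>s. (\<forall>n. simple_function (lebesgue_on {0..1}) (s n)) \<and>
          (AE t in lebesgue_on {0..1}. (\<lambda>n::nat. s n t) \<longlonglongrightarrow> f t))"

end

theory Submission
  imports Defs
begin

text \<open>
  Let \<open>\<Phi>\<close> be the primitive of \<open>\<Gamma>\<close>. By Vitali's covering theorem \<open>\<Phi> I / |I|\<close> tends to \<open>\<Gamma> t\<close> in the
  Hausdorff distance as \<open>I\<close> shrinks to \<open>t\<close>, for almost every \<open>t\<close>. Hence \<open>\<Gamma>\<close> is almost constant, up to
  any given error, on each of countably many measurable sets covering almost everything, and successive
  approximation gives a selection with the same property; strongly measurable selections have it too.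
  For such a selection \<open>f\<close> every \<open>\<phi> \<circ> f\<close> lies between two integrable support functions, and weak
  compactness of \<open>\<Phi> I\<close> yields \<open>F I \<in> \<Phi> I\<close> with \<open>\<phi> (F I) = \<integral>\<^bsub>I\<^esub> \<phi> \<circ> f\<close> for all functionals \<open>\<phi>\<close>. Since
  \<open>sup \<phi>(\<Gamma>) - \<phi> \<circ> f\<close> is nonnegative, its integral over \<open>I\<close> is at least the one over the part of \<open>I\<close> on
  which \<open>f\<close> and \<open>\<Gamma>\<close> are almost constant; at density points this gives \<open>F I / |I| \<longrightarrow> f t\<close> in norm. On the
  exceptional null set the error of \<open>F\<close> is dominated by that of \<open>\<Phi>\<close>.
\<close>

subsection \<open>Norming functionals\<close>

text \<open>The difficulty is uniformity in the functional. For each fixed \<phi>, the integral of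
  \<open>\<phi> \<circ> f\<close> is differentiable almost everywhere, but the exceptional null set
  depends on \<phi>, and convergence for every \<phi> is not convergence in norm. Hence the
  functional is chosen after the interval, as one norming the error vector, while all null sets and
  all bounds on the length of the interval are fixed beforehand, from \<open>\<Gamma>\<close>,
  \<open>f\<close> and countably many density sets alone. A one-sided bound on
  \<open>\<phi> (F I)\<close> then suffices, because the norm of the error is itself a value of
  \<phi>. Nothing is assumed about measurability of \<open>\<Gamma>\<close>, and \<open>X\<close>
  may be nonseparable. What replaces measurability is \<open>osc_cover\<close>: countably many
  measurable pieces of small oscillation, a notion that applies equally to sets, vectors and
  numbers. All integrals are gauge integrals, since the scalar functions in question may fail to be
  absolutely integrable.\<close>

definition sublinear :: "('a::real_vector \<Rightarrow> real) \<Rightarrow> bool" where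
  "sublinear p \<longleftrightarrow> (\<forall>x y. p (x + y) \<le> p x + p y) \<and> (\<forall>c x. 0 < c \<longrightarrow> p (c *\<^sub>R x) \<le> c * p x)"

lemma sublinear_add: "sublinear p \<Longrightarrow> p (x + y) \<le> p x + p y"
  by (simp add: sublinear_def)

lemma sublinear_scale:
  assumes "sublinear p" "0 < c"
  shows "p (c *\<^sub>R x) = c * p x"
proof (rule antisym)
  show "p (c *\<^sub>R x) \<le> c * p x" using assms by (simp add: sublinear_def)
  have "p (inverse c *\<^sub>R (c *\<^sub>R x)) \<le> inverse c * p (c *\<^sub>R x)"
    using assms unfolding sublinear_def by (metis positive_imp_inverse_positive)
  then show "c * p x \<le> p (c *\<^sub>R x)" using assms(2) by (simp add: field_simps)
qed

lemma sublinear_0: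
  assumes "sublinear p" shows "p 0 = 0"
  using sublinear_scale[OF assms, of 2 0] by simp

lemma sublinear_minus:
  assumes "sublinear p" shows "- p (- x) \<le> p x"
  using sublinear_add[OF assms, of x "- x"] sublinear_0[OF assms] by simp

text \<open>The infimum of \<open>p (z + l *\<^sub>R y) - l * p y\<close> over
  \<open>l \<ge> 0\<close> does both jobs: \<open>l = 0\<close> gives the bound by \<open>p\<close>,
  and \<open>l = 1\<close> the sharper one. It serves to show that a minimal \<open>p\<close> is
  additive, and also to prepare the norm so that every sublinear function below the result takes the
  right value at \<open>- y\<close>.\<close>

lemma sublinear_lower_direction:
  fixes p :: "'a::real_vector \<Rightarrow> real"
  assumes p: "sublinear p"
  obtains q where "sublinear q" "\<And>z. q z \<le> p z" "\<And>z. q z \<le> p (z + y) - p y"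
proof
  define g where "g z l = p (z + l *\<^sub>R y) - l * p y" for z and l :: real
  define q where "q z = (INF l\<in>{0..}. g z l)" for z
  have lower: "- p (- z) \<le> g z l" if "0 \<le> l" for z l
  proof (cases "l = 0")
    case True then show ?thesis using sublinear_minus[OF p] by (simp add: g_def)
  next
    case False
    have "p (l *\<^sub>R y) \<le> p (z + l *\<^sub>R y) + p (- z)"
      using sublinear_add[OF p, of "z + l *\<^sub>R y" "- z"] by simp
    then show ?thesis using sublinear_scale[OF p, of l y] False that by (simp add: g_def)
  qed
  have q_le: "q z \<le> g z l" if "0 \<le> l" for z l
    unfolding q_def using that lower by (intro cINF_lower bdd_belowI2[where m="- p (- z)"]) auto
  have le_q: "c \<le> q z" if "\<And>l. 0 \<le> l \<Longrightarrow> c \<le> g z l" for c z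
    unfolding q_def using that by (intro cINF_greatest) auto
  have "q (z + w) \<le> q z + q w" for z w
  proof -
    have "q (z + w) - g z l \<le> q w" if "0 \<le> l" for l
    proof (rule le_q)
      fix m :: real assume m: "0 \<le> m"
      have "q (z + w) \<le> g (z + w) (l + m)" using q_le that m by simp
      also have "\<dots> \<le> g z l + g w m"
        using sublinear_add[OF p, of "z + l *\<^sub>R y" "w + m *\<^sub>R y"]
        by (simp add: g_def algebra_simps)
      finally show "q (z + w) - g z l \<le> g w m" by simp
    qed
    then have "q (z + w) - q w \<le> q z" by (intro le_q) (simp add: algebra_simps)
    then show ?thesis by simp
  qed
  moreover have "q (c *\<^sub>R z) \<le> c * q z" if c: "0 < c" for c z
  proof -
    have "q (c *\<^sub>R z) / c \<le> g z l" if "0 \<le> l" for l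
    proof -
      have "q (c *\<^sub>R z) \<le> g (c *\<^sub>R z) (c * l)" using q_le c that by simp
      also have "\<dots> = c * g z l"
        using sublinear_scale[OF p c, of "z + l *\<^sub>R y"] by (simp add: g_def algebra_simps)
      finally show ?thesis using c by (simp add: field_simps)
    qed
    then have "q (c *\<^sub>R z) / c \<le> q z" by (rule le_q)
    then show ?thesis using c by (simp add: field_simps)
  qed
  ultimately show "sublinear q" by (simp add: sublinear_def)
  show "q z \<le> p z" for z using q_le[of 0 z] by (simp add: g_def)
  show "q z \<le> p (z + y) - p y" for z using q_le[of 1 z] by (simp add: g_def)
qed

text \<open>Zorn's lemma applied to the reversed order: the pointwise infimum of a chain is again
  sublinear, and it is finite because every sublinear \<open>p \<le> q\<close> satisfies
  \<open>- q (- z) \<le> p z\<close>.\<close>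

lemma minimal_sublinear_exists:
  fixes q :: "'a::real_vector \<Rightarrow> real"
  assumes q: "sublinear q"
  obtains p where "sublinear p" "p \<le> q" "\<And>p'. sublinear p' \<Longrightarrow> p' \<le> p \<Longrightarrow> p' = p"
proof -
  define A where "A = {p. sublinear p \<and> p \<le> q}"
  define R :: "('a \<Rightarrow> real) \<Rightarrow> ('a \<Rightarrow> real) \<Rightarrow> bool" where "R a u \<longleftrightarrow> u \<le> a" for a u
  have "\<exists>m\<in>A. \<forall>a\<in>A. R m a \<longrightarrow> a = m"
  proof (rule predicate_Zorn)
    show "partial_order_on A (relation_of R A)"
      by (rule partial_order_on_relation_ofI) (auto simp: R_def)
    fix C assume C: "C \<in> Chains (relation_of R A)"
    then have CA: "C \<subseteq> A" and chain: "\<And>a b. a \<in> C \<Longrightarrow> b \<in> C \<Longrightarrow> a \<le> b \<or> b \<le> a"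
      by (auto simp: Chains_def relation_of_def R_def)
    show "\<exists>u\<in>A. \<forall>a\<in>C. R a u"
    proof (cases "C = {}")
      case True then show ?thesis using q by (auto simp: A_def)
    next
      case False
      define u where "u z = (INF p\<in>C. p z)" for z
      have sub: "sublinear p" "p z \<le> q z" if "p \<in> C" for p z
        using that CA by (auto simp: A_def le_fun_def)
      have "- q (- z) \<le> p z" if "p \<in> C" for p z
        using sublinear_minus[OF sub(1)[OF that], of z] sub(2)[OF that, of "- z"] by simp
      then have u_le: "u z \<le> p z" if "p \<in> C" for p z
        unfolding u_def using that by (intro cINF_lower bdd_belowI2[where m="- q (- z)"]) auto
      have le_u: "c \<le> u z" if "\<And>p. p \<in> C \<Longrightarrow> c \<le> p z" for c z
        unfolding u_def using that False by (intro cINF_greatest) auto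
      have "u (z + w) \<le> u z + u w" for z w
      proof -
        have "u (z + w) - p z \<le> u w" if p: "p \<in> C" for p
        proof (rule le_u)
          fix p' assume p': "p' \<in> C"
          \<comment> \<open>Subadditivity of an infimum needs one function below both
            \<open>p\<close> and \<open>p'\<close>; the chain provides it.\<close>
          obtain r where r: "r \<in> C" "r \<le> p" "r \<le> p'" using chain[OF p p'] p p' by auto
          have "u (z + w) \<le> r z + r w"
            using u_le[OF r(1), of "z + w"] sublinear_add[OF sub(1)[OF r(1)], of z w] by simp
          then show "u (z + w) - p z \<le> p' w" using r(2,3)[THEN le_funD, of z] r(2,3)[THEN le_funD, of w] by simp
        qed
        then have "u (z + w) - u w \<le> u z" by (intro le_u) (simp add: algebra_simps)
        then show ?thesis by simp
      qed
      moreover have "u (c *\<^sub>R z) \<le> c * u z" if c: "0 < c" for c z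
      proof -
        have "u (c *\<^sub>R z) / c \<le> p z" if "p \<in> C" for p
          using u_le[OF that, of "c *\<^sub>R z"] sublinear_scale[OF sub(1)[OF that] c, of z] c
          by (simp add: field_simps)
        then have "u (c *\<^sub>R z) / c \<le> u z" by (rule le_u)
        then show ?thesis using c by (simp add: field_simps)
      qed
      moreover have "u \<le> q" using False u_le sub(2) unfolding le_fun_def by (metis ex_in_conv order_trans)
      ultimately have "u \<in> A" by (auto simp: A_def sublinear_def)
      then show ?thesis using u_le by (auto simp: R_def le_fun_def)
    qed
  qed
  then show ?thesis using that unfolding A_def R_def by (smt (verit) mem_Collect_eq order_trans)
qed

text \<open>Lowering \<open>p\<close> in direction \<open>y\<close> cannot change it, so the sharper
  bound of \<open>sublinear_lower_direction\<close> holds for \<open>p\<close> itself; this is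
  superadditivity.\<close>

lemma minimal_sublinear_additive:
  assumes p: "sublinear p" and min: "\<And>p'. sublinear p' \<Longrightarrow> p' \<le> p \<Longrightarrow> p' = p"
  shows "p (x + y) = p x + p y"
proof -
  obtain q where q: "sublinear q" "\<And>z. q z \<le> p z" "\<And>z. q z \<le> p (z + y) - p y"
    using sublinear_lower_direction[OF p, of y] by blast
  then have "q = p" by (intro min) (auto simp: le_fun_def)
  then have "p x \<le> p (x + y) - p y" using q(3) by auto
  then show ?thesis using sublinear_add[OF p, of x y] by simp
qed

text \<open>Hahn-Banach by way of minimal sublinear functions: one that lies below the norm lowered
  in direction \<open>x\<close> is linear, and its value at \<open>x\<close> is forced.\<close>

lemma norming_functional:
  fixes x :: "'a::real_normed_vector"
  obtains \<phi> :: "'a \<Rightarrow> real"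
  where "bounded_linear \<phi>" "\<And>y. \<bar>\<phi> y\<bar> \<le> norm y" "\<phi> x = norm x"
proof -
  have "sublinear (norm :: 'a \<Rightarrow> real)" by (simp add: sublinear_def norm_triangle_ineq)
  then obtain q where q: "sublinear q" "\<And>z. q z \<le> norm z" "\<And>z. q z \<le> norm (z + x) - norm x"
    using sublinear_lower_direction[of norm x] by blast
  obtain p where p: "sublinear p" "p \<le> q" "\<And>p'. sublinear p' \<Longrightarrow> p' \<le> p \<Longrightarrow> p' = p"
    using minimal_sublinear_exists[OF q(1)] by blast
  have add: "p (y + z) = p y + p z" for y z
    by (rule minimal_sublinear_additive[OF p(1,3)])
  have minus: "p (- y) = - p y" for y
    using add[of y "- y"] sublinear_0[OF p(1)] by simp
  have le: "p y \<le> norm y" for y using p(2) q(2) by (meson le_funD order_trans)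
  then have abs_le: "\<bar>p y\<bar> \<le> norm y" for y using le[of "- y"] minus[of y] by (simp add: abs_le_iff)
  have scale: "p (c *\<^sub>R y) = c * p y" for c y
  proof (cases c "0::real" rule: linorder_cases)
    case less
    then show ?thesis using sublinear_scale[OF p(1), of "- c" y] minus[of "c *\<^sub>R y"] by simp
  next
    case equal
    then show ?thesis using sublinear_0[OF p(1)] by simp
  next
    case greater
    then show ?thesis by (rule sublinear_scale[OF p(1)])
  qed
  \<comment> \<open>The lowered norm at \<open>- x\<close> is at most
    \<open>norm (- x + x) - norm x\<close>.\<close>
  have "p (- x) \<le> - norm x" using q(3)[of "- x"] le_funD[OF p(2), of "- x"] by simp
  then have "p x = norm x" using minus[of x] le[of x] by simp
  moreover have "bounded_linear p"
    using add scale abs_le by (intro bounded_linear_intro[where K=1]) auto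
  ultimately show ?thesis using abs_le that by blast
qed

lemma functionals_separate:
  fixes x y :: "'a::real_normed_vector"
  assumes "\<And>\<phi> :: 'a \<Rightarrow> real. bounded_linear \<phi> \<Longrightarrow> \<phi> x = \<phi> y"
  shows "x = y"
proof -
  obtain \<phi> :: "'a \<Rightarrow> real" where "bounded_linear \<phi>" "\<phi> (x - y) = norm (x - y)"
    by (rule norming_functional[of "x - y"]) blast
  then show ?thesis using assms[of \<phi>] by (simp add: bounded_linear.linear linear_diff)
qed

subsection \<open>Weakly compact sets\<close>

lemma closedin_weak_topology_slab:
  assumes "bounded_linear (\<phi> :: 'a::real_normed_vector \<Rightarrow> real)"
  shows "closedin weak_topology {x. \<bar>\<phi> x - c\<bar> \<le> e}"
proof -
  have top: "topspace (weak_topology :: 'a topology) = UNIV"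
    unfolding weak_topology_def topology_generated_by_topspace
    using assms open_UNIV by blast
  have "- {x. \<bar>\<phi> x - c\<bar> \<le> e} = \<phi> -` (- cball c e)"
    by (auto simp: dist_real_def abs_minus_commute)
  moreover have "openin weak_topology (\<phi> -` (- cball c e))"
    unfolding weak_topology_def by (rule topology_generated_by_Basis) (use assms in blast)
  ultimately show ?thesis by (simp add: closedin_def top Compl_eq_Diff_UNIV)
qed

text \<open>Finite intersection property for the weakly closed slabs
  \<open>\<bar>\<phi> x - l \<phi>\<bar> \<le> e\<close>. It upgrades approximate solvability for
  finitely many functionals to exact solvability for all of them; \<open>l\<close> will be
  evaluation at a point, and later integration of \<open>\<phi> \<circ> f\<close>.\<close>

lemma weakly_compact_represents:
  fixes C :: "'a::real_normed_vector set" and l :: "('a \<Rightarrow> real) \<Rightarrow> real"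
  assumes C: "compactin weak_topology C"
    and approx: "\<And>S e. finite S \<Longrightarrow> (\<And>\<phi>. \<phi> \<in> S \<Longrightarrow> bounded_linear \<phi>) \<Longrightarrow> 0 < e \<Longrightarrow>
                   \<exists>x\<in>C. \<forall>\<phi>\<in>S. \<bar>\<phi> x - l \<phi>\<bar> \<le> e"
  shows "\<exists>x\<in>C. \<forall>\<phi>. bounded_linear \<phi> \<longrightarrow> \<phi> x = l \<phi>"
proof -
  define slab where "slab = (\<lambda>(\<phi>::'a \<Rightarrow> real, e). {x. \<bar>\<phi> x - l \<phi>\<bar> \<le> e})"
  define K where "K = {\<phi> :: 'a \<Rightarrow> real. bounded_linear \<phi>} \<times> {0::real<..}"
  have "C \<inter> \<Inter>(slab ` K) \<noteq> {}"
  proof (rule compactin_fip[THEN iffD1, OF C, THEN conjunct2, rule_format])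
    show "(\<forall>D\<in>slab ` K. closedin weak_topology D) \<and>
      (\<forall>\<F>. finite \<F> \<and> \<F> \<subseteq> slab ` K \<longrightarrow> C \<inter> \<Inter> \<F> \<noteq> {})"
    proof (intro conjI ballI allI impI)
      show "closedin weak_topology D" if "D \<in> slab ` K" for D
        using that by (auto simp: slab_def K_def closedin_weak_topology_slab)
      fix \<F> assume "finite \<F> \<and> \<F> \<subseteq> slab ` K"
      then obtain k where k: "finite k" "k \<subseteq> K" "\<F> = slab ` k"
        by (meson finite_subset_image)
      \<comment> \<open>One tolerance for all slabs of the finite family; the inserted
        \<open>1\<close> keeps the minimum meaningful for the empty family.\<close>
      define e where "e = Min (insert 1 (snd ` k))"
      have "0 < e" using k by (auto simp: e_def K_def)
      moreover have "finite (fst ` k)" "\<And>\<phi>. \<phi> \<in> fst ` k \<Longrightarrow> bounded_linear \<phi>"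
        using k by (auto simp: K_def)
      ultimately obtain x where x: "x \<in> C" "\<forall>\<phi>\<in>fst ` k. \<bar>\<phi> x - l \<phi>\<bar> \<le> e"
        using approx by blast
      have "\<bar>fst z x - l (fst z)\<bar> \<le> snd z" if "z \<in> k" for z
      proof -
        have "e \<le> snd z" unfolding e_def using k that by (intro Min_le) auto
        then show ?thesis using x that by fastforce
      qed
      then have "x \<in> \<Inter>\<F>" using k by (auto simp: slab_def)
      then show "C \<inter> \<Inter>\<F> \<noteq> {}" using x by blast
    qed
  qed
  then obtain x where x: "x \<in> C" "\<And>\<phi> e. bounded_linear \<phi> \<Longrightarrow> 0 < e \<Longrightarrow> \<bar>\<phi> x - l \<phi>\<bar> \<le> e"
    by (fastforce simp: slab_def K_def)
  have "\<phi> x = l \<phi>" if "bounded_linear \<phi>" for \<phi>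
    using field_le_epsilon[of "\<bar>\<phi> x - l \<phi>\<bar>" 0] x(2)[OF that] by auto
  then show ?thesis using x(1) by blast
qed

text \<open>A norm limit \<open>y\<close> of points of \<open>C\<close> is approximated by points of
  \<open>C\<close> under any finitely many functionals, so evaluation at \<open>y\<close> is
  represented in \<open>C\<close>, and functionals separate points.\<close>

lemma weakly_compact_closed:
  fixes C :: "'a::real_normed_vector set"
  assumes C: "compactin weak_topology C"
    and y: "\<And>e. 0 < e \<Longrightarrow> \<exists>x\<in>C. dist x y < e"
  shows "y \<in> C"
proof -
  have approx: "\<exists>x\<in>C. \<forall>\<phi>\<in>S. \<bar>\<phi> x - \<phi> y\<bar> \<le> e"
    if S: "finite S" "\<And>\<phi>. \<phi> \<in> S \<Longrightarrow> bounded_linear \<phi>" and e: "0 < e"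
    for S :: "('a \<Rightarrow> real) set" and e
  proof -
    have "\<forall>\<^sub>F x in nhds y. \<forall>\<phi>\<in>S. dist (\<phi> x) (\<phi> y) < e"
    proof (intro eventually_ball_finite ballI S(1))
      fix \<phi> assume "\<phi> \<in> S"
      then have "isCont \<phi> y" by (simp add: S(2) linear_continuous_at)
      then show "\<forall>\<^sub>F x in nhds y. dist (\<phi> x) (\<phi> y) < e"
        using e by (simp add: isCont_def tendsto_at_iff_tendsto_nhds tendstoD)
    qed
    then obtain d where "d > 0" "\<And>x. dist x y < d \<Longrightarrow> \<forall>\<phi>\<in>S. dist (\<phi> x) (\<phi> y) < e"
      unfolding eventually_nhds_metric by blast
    moreover obtain x where "x \<in> C" "dist x y < d" using y[of d] \<open>d > 0\<close> by blast
    ultimately show ?thesis by (metis dist_real_def less_imp_le)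
  qed
  have "\<exists>x\<in>C. \<forall>\<phi> :: 'a \<Rightarrow> real. bounded_linear \<phi> \<longrightarrow> \<phi> x = \<phi> y"
    by (rule weakly_compact_represents[OF C, of "\<lambda>\<phi>. \<phi> y", OF approx])
  then show ?thesis using functionals_separate by metis
qed

lemma weakly_compact_functional_bounded:
  assumes C: "compactin weak_topology C" and \<phi>: "bounded_linear (\<phi> :: 'a::real_normed_vector \<Rightarrow> real)"
  obtains B where "\<And>x. x \<in> C \<Longrightarrow> \<bar>\<phi> x\<bar> \<le> B"
proof -
  define \<U> where "\<U> = range (\<lambda>n::nat. \<phi> -` ball 0 (real n))"
  have "\<exists>\<F>. finite \<F> \<and> \<F> \<subseteq> \<U> \<and> C \<subseteq> \<Union>\<F>"
  proof (rule compactinD[OF C])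
    show "openin weak_topology U" if "U \<in> \<U>" for U
      using that \<phi> unfolding \<U>_def weak_topology_def by (auto intro!: topology_generated_by_Basis)
    show "C \<subseteq> \<Union>\<U>" unfolding \<U>_def using reals_Archimedean2 by force
  qed
  then obtain F where F: "finite F" "C \<subseteq> (\<Union>n\<in>F. \<phi> -` ball 0 (real n))"
    unfolding \<U>_def by (metis finite_subset_image)
  have "\<bar>\<phi> x\<bar> \<le> Max (insert 0 (real ` F))" if x: "x \<in> C" for x
  proof -
    obtain n where n: "n \<in> F" "\<bar>\<phi> x\<bar> < real n" using F(2) x by auto
    then have "real n \<le> Max (insert 0 (real ` F))" using F(1) by (intro Max_ge) auto
    then show ?thesis using n by simp
  qed
  then show ?thesis using that by blast
qed

text \<open>Uniform boundedness: Baire's theorem in the dual, the points of \<open>C\<close> acting as functionals.\<close>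

lemma weakly_compact_bounded:
  fixes C :: "'a::real_normed_vector set"
  assumes C: "compactin weak_topology C"
  shows "bounded C"
proof -
  define E where "E n = {\<phi> :: 'a \<Rightarrow>\<^sub>L real. \<forall>x\<in>C. \<bar>blinfun_apply \<phi> x\<bar> \<le> real n}" for n :: nat
  have E_alt: "E n = (\<Inter>x\<in>C. {\<phi>. \<bar>blinfun_apply \<phi> x\<bar> \<le> real n})" for n
    by (auto simp: E_def)
  have closed: "closed (E n)" for n
    unfolding E_alt by (intro closed_INT ballI closed_Collect_le continuous_intros)
  have un: "(\<Union>n. E n) = UNIV"
  proof -
    have "\<exists>n. \<phi> \<in> E n" for \<phi>
    proof -
      obtain B where B: "\<And>x. x \<in> C \<Longrightarrow> \<bar>blinfun_apply \<phi> x\<bar> \<le> B"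
        using weakly_compact_functional_bounded[OF C blinfun.bounded_linear_right] by blast
      obtain n where "B \<le> real n" using real_arch_simple by blast
      then have "\<phi> \<in> E n" using B by (auto simp: E_def intro: order_trans)
      then show ?thesis by blast
    qed
    then show ?thesis by blast
  qed
  have "\<exists>n. interior (E n) \<noteq> {}"
  proof (rule ccontr)
    assume "\<nexists>n. interior (E n) \<noteq> {}"
    then have "Met_TC.mtopology interior_of \<Union>(range E) = {}"
      using closed
      by (intro Met_TC.metric_Baire_category_alt) (auto simp: Met_TC.mcomplete_def complete_UNIV)
    then show False using un by simp
  qed
  then obtain n \<phi>0 where "\<phi>0 \<in> interior (E n)" by blast
  then obtain r where r: "0 < r" "cball \<phi>0 r \<subseteq> E n"
    by (meson open_contains_cball open_interior interior_subset order_trans)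
  have "norm x \<le> 2 * real n / r" if x: "x \<in> C" for x
  proof -
    obtain \<psi> where psi: "bounded_linear \<psi>" "\<And>y. \<bar>\<psi> y\<bar> \<le> norm y" "\<psi> x = norm x"
      using norming_functional[of x] by blast
    define \<psi>' where "\<psi>' = Blinfun \<psi>"
    have ap: "blinfun_apply \<psi>' = \<psi>" using psi(1) by (simp add: \<psi>'_def bounded_linear_Blinfun_apply)
    have "norm \<psi>' \<le> 1" by (rule norm_blinfun_bound) (use psi(2) ap in auto)
    \<comment> \<open>Two points of one ball in \<open>E n\<close>: their difference
      \<open>r *\<^sub>R \<psi>'\<close> takes the value \<open>r * norm x\<close> at
      \<open>x\<close>, which is therefore at most \<open>2 * n\<close>.\<close>
    then have "\<phi>0 + r *\<^sub>R \<psi>' \<in> E n" "\<phi>0 \<in> E n"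
      using r by (auto intro!: subsetD[OF r(2)] simp: dist_norm)
    then have "\<bar>\<phi>0 x + r * norm x\<bar> \<le> real n" "\<bar>\<phi>0 x\<bar> \<le> real n"
      using x psi(3) ap by (auto simp: E_def blinfun.add_left blinfun.scaleR_left)
    then have "r * norm x \<le> 2 * real n" by linarith
    then show ?thesis using r(1) by (simp add: field_simps)
  qed
  then show ?thesis by (auto simp: bounded_iff)
qed

lemma cwkD:
  assumes "C \<in> cwk" shows "C \<noteq> {}" "bounded C" "compactin weak_topology C"
  using assms weakly_compact_bounded by (auto simp: cwk_def)

subsection \<open>Hausdorff distance and support functions\<close>

text \<open>Hausdorff closeness without suprema: symmetry, the triangle inequality and scaling hold
  for arbitrary sets, so boundedness enters only in the passage from \<open>hausdorff_dist\<close>.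
  The strict inequality supplies witnesses, at the price of a little slack in that passage.\<close>

definition hclose :: "real \<Rightarrow> 'a::metric_space set \<Rightarrow> 'a set \<Rightarrow> bool" where
  "hclose e A B \<longleftrightarrow> (\<forall>a\<in>A. \<exists>b\<in>B. dist a b < e) \<and> (\<forall>b\<in>B. \<exists>a\<in>A. dist a b < e)"

lemma hclose_sym: "hclose e A B \<Longrightarrow> hclose e B A"
  by (simp add: hclose_def dist_commute)

lemma hclose_trans:
  assumes "hclose d A B" "hclose e B C" shows "hclose (d + e) A C"
  unfolding hclose_def
proof (intro conjI ballI)
  fix a assume "a \<in> A"
  then obtain b c where "b \<in> B" "dist a b < d" "c \<in> C" "dist b c < e"
    using assms unfolding hclose_def by meson
  then show "\<exists>c\<in>C. dist a c < d + e" using dist_triangle[of a c b] by force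
next
  fix c assume "c \<in> C"
  then obtain b a where "b \<in> B" "dist b c < e" "a \<in> A" "dist a b < d"
    using assms unfolding hclose_def by meson
  then show "\<exists>a\<in>A. dist a c < d + e" using dist_triangle[of a c b] by force
qed

lemma hclose_scaleR:
  fixes A B :: "'a::real_normed_vector set"
  assumes "hclose e A B" "0 < c"
  shows "hclose (c * e) ((*\<^sub>R) c ` A) ((*\<^sub>R) c ` B)"
proof -
  have "dist (c *\<^sub>R a) (c *\<^sub>R b) = c * dist a b" for a b :: 'a
    using assms(2) by (simp add: dist_norm flip: scaleR_diff_right)
  then show ?thesis using assms unfolding hclose_def by simp
qed

lemma bdd_above_infdist:
  assumes "bounded A" "B \<noteq> {}" shows "bdd_above ((\<lambda>a. infdist a B) ` A)"
proof -
  obtain b where b: "b \<in> B" using assms by blast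
  obtain r where "\<And>a. a \<in> A \<Longrightarrow> dist b a \<le> r" using assms(1) bounded_any_center by blast
  then show ?thesis
    using infdist_le[OF b] by (intro bdd_aboveI2[where M=r]) (metis dist_commute order_trans)
qed

lemma infdist_le_hausdorff_dist:
  assumes "bounded A" "B \<noteq> {}" "a \<in> A"
  shows "infdist a B \<le> hausdorff_dist A B" "infdist a B \<le> hausdorff_dist B A"
  using cSUP_upper[OF assms(3) bdd_above_infdist[OF assms(1,2)]]
  by (auto simp: hausdorff_dist_def)

lemma hausdorff_dist_nonneg:
  assumes "bounded A" "A \<noteq> {}" "B \<noteq> {}" shows "0 \<le> hausdorff_dist A B"
  using assms infdist_le_hausdorff_dist(1)[OF assms(1,3)] infdist_nonneg by (metis ex_in_conv order_trans)

lemma infdist_less_ex: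
  assumes "B \<noteq> {}" "infdist a B < e" shows "\<exists>b\<in>B. dist a b < e"
  using assms cINF_less_iff[of B "dist a" e] by (simp add: infdist_notempty)

lemma hausdorff_dist_less_imp_hclose:
  assumes "bounded A" "A \<noteq> {}" "bounded B" "B \<noteq> {}" "hausdorff_dist A B < e"
  shows "hclose e A B"
proof -
  have "\<exists>b\<in>B. dist a b < e" if "a \<in> A" for a
    using infdist_le_hausdorff_dist(1)[OF assms(1,4) that] assms(4,5) by (intro infdist_less_ex) auto
  moreover have "\<exists>a\<in>A. dist b a < e" if "b \<in> B" for b
    using infdist_le_hausdorff_dist(2)[OF assms(3,2) that] assms(2,5) by (intro infdist_less_ex) auto
  ultimately show ?thesis by (simp add: hclose_def dist_commute)
qed

definition support :: "('a \<Rightarrow> real) \<Rightarrow> 'a set \<Rightarrow> real" where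
  "support \<phi> A = (SUP x\<in>A. \<phi> x)"

lemma bdd_above_functional:
  assumes "bounded A" "bounded_linear (\<phi> :: 'a::real_normed_vector \<Rightarrow> real)"
  shows "bdd_above (\<phi> ` A)"
  by (rule bounded_imp_bdd_above[OF bounded_linear_image[OF assms]])

lemma support_upper:
  assumes "bounded A" "bounded_linear (\<phi> :: 'a::real_normed_vector \<Rightarrow> real)" "x \<in> A"
  shows "\<phi> x \<le> support \<phi> A"
  unfolding support_def using assms by (intro cSUP_upper bdd_above_functional)

lemma support_least:
  assumes "A \<noteq> {}" "\<And>x. x \<in> A \<Longrightarrow> \<phi> x \<le> c" shows "support \<phi> A \<le> c"
  unfolding support_def using assms by (rule cSUP_least)

lemma support_plus:
  assumes "bounded A" "A \<noteq> {}" "bounded B" "B \<noteq> {}"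
    and \<phi>: "bounded_linear (\<phi> :: 'a::real_normed_vector \<Rightarrow> real)"
  shows "support \<phi> (A + B) = support \<phi> A + support \<phi> B"
proof (rule antisym)
  have "bounded (A + B)"
    using bounded_plus[OF assms(1,3)] by (simp add: set_plus_image)
  note up = support_upper[OF this \<phi>]
  show "support \<phi> (A + B) \<le> support \<phi> A + support \<phi> B"
  proof (rule support_least)
    show "A + B \<noteq> {}" using assms by (auto simp: set_plus_def)
    fix x assume "x \<in> A + B"
    then show "\<phi> x \<le> support \<phi> A + support \<phi> B"
      using assms \<phi> by (auto elim!: set_plus_elim simp: bounded_linear.linear linear_add
          intro!: add_mono support_upper)
  qed
  have "support \<phi> A \<le> support \<phi> (A + B) - support \<phi> B"
  proof (rule support_least[OF assms(2)])
    fix a assume a: "a \<in> A"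
    have "support \<phi> B \<le> support \<phi> (A + B) - \<phi> a"
    proof (rule support_least[OF assms(4)])
      fix b assume "b \<in> B"
      then have "\<phi> (a + b) \<le> support \<phi> (A + B)" using a by (intro up set_plus_intro)
      then show "\<phi> b \<le> support \<phi> (A + B) - \<phi> a" using \<phi> by (simp add: bounded_linear.linear linear_add)
    qed
    then show "\<phi> a \<le> support \<phi> (A + B) - support \<phi> B" by simp
  qed
  then show "support \<phi> A + support \<phi> B \<le> support \<phi> (A + B)" by simp
qed

lemma support_scaleR:
  assumes "bounded A" "A \<noteq> {}" "0 \<le> c"
    and \<phi>: "bounded_linear (\<phi> :: 'a::real_normed_vector \<Rightarrow> real)"
  shows "support \<phi> ((*\<^sub>R) c ` A) = c * support \<phi> A"
proof (cases "c = 0")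
  case True
  then show ?thesis using assms by (simp add: support_def image_image bounded_linear.linear linear_0)
next
  case False
  have bd: "bounded ((*\<^sub>R) c ` A)" using assms(1) by (rule bounded_scaling)
  have lin: "\<phi> (c *\<^sub>R x) = c * \<phi> x" for x using \<phi> by (simp add: bounded_linear.linear linear_scale)
  show ?thesis
  proof (rule antisym)
    show "support \<phi> ((*\<^sub>R) c ` A) \<le> c * support \<phi> A"
      using assms lin by (intro support_least) (auto intro!: mult_left_mono support_upper)
    have "support \<phi> A \<le> support \<phi> ((*\<^sub>R) c ` A) / c"
    proof (rule support_least[OF assms(2)])
      fix x assume "x \<in> A"
      then have "\<phi> (c *\<^sub>R x) \<le> support \<phi> ((*\<^sub>R) c ` A)" by (intro support_upper[OF bd \<phi>]) auto
      then show "\<phi> x \<le> support \<phi> ((*\<^sub>R) c ` A) / c" using lin False assms(3) by (simp add: field_simps)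
    qed
    then show "c * support \<phi> A \<le> support \<phi> ((*\<^sub>R) c ` A)" using False assms(3) by (simp add: field_simps)
  qed
qed

lemma support_hclose_le:
  assumes "bounded B" "A \<noteq> {}" "hclose e A B" "0 \<le> K"
    and \<phi>: "bounded_linear (\<phi> :: 'a::real_normed_vector \<Rightarrow> real)" "\<And>y. \<bar>\<phi> y\<bar> \<le> K * norm y"
  shows "support \<phi> A \<le> support \<phi> B + K * e"
proof (rule support_least[OF assms(2)])
  fix a assume "a \<in> A"
  then obtain b where b: "b \<in> B" "dist a b < e" using assms(3) unfolding hclose_def by blast
  have "\<phi> a - \<phi> b \<le> K * norm (a - b)"
    using \<phi>(2)[of "a - b"] \<phi>(1) by (simp add: bounded_linear.linear linear_diff abs_le_iff)
  also have "\<dots> \<le> K * e" using b assms(4) by (intro mult_left_mono) (auto simp: dist_norm)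
  finally show "\<phi> a \<le> support \<phi> B + K * e" using support_upper[OF assms(1) \<phi>(1) b(1)] by simp
qed

lemma support_hclose:
  assumes "bounded A" "bounded B" "A \<noteq> {}" "B \<noteq> {}" "hclose e A B" "0 \<le> K"
    and \<phi>: "bounded_linear (\<phi> :: 'a::real_normed_vector \<Rightarrow> real)" "\<And>y. \<bar>\<phi> y\<bar> \<le> K * norm y"
  shows "\<bar>support \<phi> A - support \<phi> B\<bar> \<le> K * e"
  using support_hclose_le[OF assms(2,3,5,6) \<phi>] support_hclose_le[OF assms(1,4) hclose_sym[OF assms(5)] assms(6) \<phi>]
  by (simp add: abs_le_iff)

lemma support_hausdorff_dist:
  assumes "bounded A" "bounded B" "A \<noteq> {}" "B \<noteq> {}" "0 \<le> K"
    and \<phi>: "bounded_linear (\<phi> :: 'a::real_normed_vector \<Rightarrow> real)" "\<And>y. \<bar>\<phi> y\<bar> \<le> K * norm y"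
  shows "\<bar>support \<phi> A - support \<phi> B\<bar> \<le> K * hausdorff_dist A B"
proof (rule field_le_epsilon)
  fix e :: real assume e: "0 < e"
  \<comment> \<open>The slack demanded by the strict \<open>hclose\<close>; dividing by
    \<open>K + 1\<close> rather than \<open>K\<close> covers \<open>K = 0\<close>.\<close>
  define d where "d = e / (K + 1)"
  have "0 < d" "K * d \<le> e" using e assms(5) by (auto simp: d_def field_simps)
  moreover have "\<bar>support \<phi> A - support \<phi> B\<bar> \<le> K * (hausdorff_dist A B + d)"
    using assms \<open>0 < d\<close> by (intro support_hclose hausdorff_dist_less_imp_hclose) auto
  ultimately show "\<bar>support \<phi> A - support \<phi> B\<bar> \<le> K * hausdorff_dist A B + e"
    by (simp add: algebra_simps)
qed

subsection \<open>Sums over fine partitions\<close>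

text \<open>The gaps are filled by any division with any tags, and the result is then refined by
  Cousin's lemma in the form that leaves pieces that are already fine untouched; all pieces of
  \<open>p\<close> are of this kind.\<close>

lemma fine_partial_division_extends:
  assumes \<delta>: "\<And>t. t \<in> {0..1} \<Longrightarrow> 0 < \<delta> t"
    and p: "p tagged_partial_division_of {0..1}" "(\<lambda>t. {t - \<delta> t <..< t + \<delta> t}) fine p"
  obtains q where "p \<subseteq> q" "fine_perron_partition \<delta> q"
proof -
  define \<gamma> where "\<gamma> t = (if t \<in> {0..1} then {t - \<delta> t <..< t + \<delta> t} else UNIV)" for t :: real
  have gauge: "gauge \<gamma>" using \<delta> by (auto simp: gauge_def \<gamma>_def)
  obtain q where q: "q tagged_division_of (cbox 0 1)" "\<gamma> fine q" "p \<subseteq> q"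
  proof -
    note pD = tagged_partial_division_ofD[OF p(1)]
    have div: "snd ` p division_of \<Union>(snd ` p)"
      using partial_division_of_tagged_division[OF p(1)] .
    have "\<Union>(snd ` p) \<subseteq> cbox 0 1" using pD(3) by force
    then obtain D where D: "snd ` p \<subseteq> D" "D division_of cbox 0 (1::real)"
      using partial_division_extend_interval[OF div] by blast
    define tag where "tag k = (SOME x. x \<in> k)" for k :: "real set"
    have tag: "tag k \<in> k" if "k \<in> D" for k
      using division_ofD(3)[OF D(2) that] unfolding tag_def by (simp add: some_in_eq)
    define r where "r = p \<union> (\<lambda>k. (tag k, k)) ` (D - snd ` p)"
    have rD: "k \<in> D" "(x, k) \<in> p \<or> x = tag k \<and> k \<notin> snd ` p" if "(x, k) \<in> r" for x k
      using that D(1) by (force simp: r_def)+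
    have snd: "k \<in> snd ` p" if "(x, k) \<in> p" for x k using that by force
    have "r tagged_division_of cbox 0 1"
    proof (rule tagged_division_ofI)
      show "finite r" using pD(1) D(2) by (auto simp: r_def)
      show "x \<in> k" "k \<subseteq> cbox 0 1" "\<exists>a b. k = cbox a b" if "(x, k) \<in> r" for x k
      proof -
        have "k \<in> D" using that rD(1) by blast
        then show "k \<subseteq> cbox 0 1" "\<exists>a b. k = cbox a b" using division_ofD(2,4)[OF D(2)] by blast+
        show "x \<in> k" using rD[OF that] pD(2) tag by blast
      qed
      show "interior k1 \<inter> interior k2 = {}"
        if "(x1, k1) \<in> r" "(x2, k2) \<in> r" "(x1, k1) \<noteq> (x2, k2)" for x1 k1 x2 k2
      proof (cases "(x1, k1) \<in> p \<and> (x2, k2) \<in> p")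
        case True then show ?thesis using pD(5) that(3) by blast
      next
        case False
        then have "k1 \<noteq> k2" using that(3) rD(2)[OF that(1)] rD(2)[OF that(2)] snd by blast
        moreover have "k1 \<in> D" "k2 \<in> D" using that(1,2) rD(1) by blast+
        ultimately show ?thesis using division_ofD(5)[OF D(2)] by blast
      qed
      have "{k. \<exists>x. (x, k) \<in> r} = D" 
      proof (intro equalityI subsetI)
        show "k \<in> D" if "k \<in> {k. \<exists>x. (x, k) \<in> r}" for k using that rD(1) by blast
        show "k \<in> {k. \<exists>x. (x, k) \<in> r}" if "k \<in> D" for k
          using that by (cases "k \<in> snd ` p") (auto simp: r_def)
      qed
      then show "\<Union>{k. \<exists>x. (x, k) \<in> r} = cbox 0 1" using division_ofD(6)[OF D(2)] by simp
    qed
    then obtain q where q: "q tagged_division_of (cbox 0 1)" "\<gamma> fine q"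
      "\<forall>(x, K)\<in>r. K \<subseteq> \<gamma> x \<longrightarrow> (x, K) \<in> q"
      using tagged_division_finer[OF _ gauge] by blast
    have "p \<subseteq> q"
    proof (clarify)
      fix x k assume xk: "(x, k) \<in> p"
      then have "x \<in> {0..1}" using pD(2,3) by blast
      moreover have "k \<subseteq> {x - \<delta> x <..< x + \<delta> x}" using fineD[OF p(2) xk] .
      ultimately have "k \<subseteq> \<gamma> x" by (simp add: \<gamma>_def)
      moreover have "(x, k) \<in> r" using xk by (simp add: r_def)
      ultimately show "(x, k) \<in> q" using q(3) by fast
    qed
    then show ?thesis using that q by blast
  qed
  have "k \<subseteq> {t - \<delta> t <..< t + \<delta> t}" if "(t, k) \<in> q" for t k
  proof -
    have "t \<in> {0..1}" using tagged_division_ofD(2,3)[OF q(1) that] by auto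
    then show ?thesis using fineD[OF q(2) that] by (simp add: \<gamma>_def)
  qed
  then have "fine_perron_partition \<delta> q"
    using q(1) by (simp add: fine_perron_partition_def fineI)
  then show ?thesis by (rule that[OF q(3)])
qed

text \<open>
  The common form of the conditions defining variational integrability: \<open>w t I\<close> is the error
  committed on the tagged interval \<open>(t, I)\<close>.
\<close>

definition variationally_null :: "(real \<Rightarrow> real set \<Rightarrow> real) \<Rightarrow> bool" where
  "variationally_null w \<longleftrightarrow>
     (\<forall>\<epsilon>>0. \<exists>\<delta>. (\<forall>t\<in>{0..1}. \<delta> t > 0) \<and>
        (\<forall>p. fine_perron_partition \<delta> p \<longrightarrow> (\<Sum>(t, I)\<in>p. w t I) < \<epsilon>))"

lemma tagged_partial_division_subintervals:
  assumes "p tagged_partial_division_of {0..1}" "(t, I) \<in> p"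
  shows "t \<in> {0..1}" "I \<in> subintervals" "t \<in> I"
proof -
  note D = tagged_partial_division_ofD(2-4)[OF assms]
  show "t \<in> I" by (fact D(1))
  show "t \<in> {0..1}" using D by blast
  obtain a b where ab: "I = {a..b}" using D(3) by auto
  then have "a \<le> b" using D(1) by auto
  then show "I \<in> subintervals" using ab D(2) by (auto simp: subintervals_def)
qed

text \<open>Extending a partial partition to a full one only adds nonnegative terms. This is what
  allows sums over the scattered intervals of a Vitali family.\<close>

lemma variationally_null_partial:
  assumes w: "variationally_null w" and e: "0 < \<epsilon>"
    and nonneg: "\<And>t I. t \<in> {0..1} \<Longrightarrow> I \<in> subintervals \<Longrightarrow> 0 \<le> w t I"
  obtains \<delta> where "\<And>t. t \<in> {0..1} \<Longrightarrow> \<delta> t > 0"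
    "\<And>p. p tagged_partial_division_of {0..1} \<Longrightarrow> (\<lambda>t. {t - \<delta> t <..< t + \<delta> t}) fine p \<Longrightarrow>
       (\<Sum>(t, I)\<in>p. w t I) < \<epsilon>"
proof -
  obtain \<delta> where \<delta>: "\<forall>t\<in>{0..1}. \<delta> t > 0"
    "\<And>p. fine_perron_partition \<delta> p \<Longrightarrow> (\<Sum>(t, I)\<in>p. w t I) < \<epsilon>"
    using w[unfolded variationally_null_def, rule_format, OF e] by blast
  have "(\<Sum>(t, I)\<in>p. w t I) < \<epsilon>"
    if p: "p tagged_partial_division_of {0..1}" "(\<lambda>t. {t - \<delta> t <..< t + \<delta> t}) fine p" for p
  proof -
    obtain q where q: "p \<subseteq> q" "fine_perron_partition \<delta> q"
      using fine_partial_division_extends[OF _ p] \<delta>(1) by blast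
    then have q': "q tagged_partial_division_of {0..1}"
      by (auto simp: fine_perron_partition_def tagged_division_of_def)
    then have "(\<Sum>(t, I)\<in>p. w t I) \<le> (\<Sum>(t, I)\<in>q. w t I)"
      using q tagged_partial_division_subintervals[OF q'] nonneg
      by (intro sum_mono2) (auto simp: tagged_partial_division_of_def)
    then show ?thesis using \<delta>(2)[OF q(2)] by simp
  qed
  then show ?thesis using that \<delta>(1) by blast
qed

text \<open>An upper bound for the ratio of \<open>w t I\<close> to the length of \<open>I\<close>,
  over all short nondegenerate intervals that contain \<open>t\<close>, with \<open>t\<close>
  possibly an endpoint, as for the tags of a Perron partition.\<close>

definition rate_le :: "real \<Rightarrow> (real \<Rightarrow> real set \<Rightarrow> real) \<Rightarrow> real \<Rightarrow> bool" where
  "rate_le \<epsilon> w t \<longleftrightarrow>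
     (\<exists>\<eta>>0. \<forall>a b. 0 \<le> a \<and> a \<le> t \<and> t \<le> b \<and> b \<le> 1 \<and> a < b \<and> b - a < \<eta> \<longrightarrow>
        w t {a..b} \<le> \<epsilon> * (b - a))"

definition vanishing_rate_at :: "(real \<Rightarrow> real set \<Rightarrow> real) \<Rightarrow> real \<Rightarrow> bool" where
  "vanishing_rate_at w t \<longleftrightarrow> (\<forall>\<epsilon>>0. rate_le \<epsilon> w t)"

lemma rate_le_mono:
  assumes "rate_le d w t" "d \<le> e" shows "rate_le e w t"
proof -
  have "d * (b - a) \<le> e * (b - a)" if "a < b" for a b :: real
    using assms(2) that by (intro mult_right_mono) auto
  then show ?thesis using assms(1) unfolding rate_le_def by (meson order_trans)
qed

lemma ae_vanishing_rate:
  assumes "\<And>e. 0 < e \<Longrightarrow> negligible {t \<in> {0..1}. \<not> rate_le e w t}"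
  shows "negligible {t \<in> {0..1}. \<not> vanishing_rate_at w t}"
proof -
  have "t \<in> (\<Union>n. {t \<in> {0..1}. \<not> rate_le (inverse (real (Suc n))) w t})"
    if t: "t \<in> {0..1}" "0 < e" "\<not> rate_le e w t" for t e
  proof -
    obtain n where "inverse (real (Suc n)) < e" using reals_Archimedean[OF t(2)] by blast
    then have "\<not> rate_le (inverse (real (Suc n))) w t" using t(3) rate_le_mono by (meson less_imp_le)
    then show ?thesis using t(1) by blast
  qed
  then have "{t \<in> {0..1}. \<not> vanishing_rate_at w t} \<subseteq>
      (\<Union>n. {t \<in> {0..1}. \<not> rate_le (inverse (real (Suc n))) w t})"
    unfolding vanishing_rate_at_def by blast
  moreover have "negligible {t \<in> {0..1}. \<not> rate_le (inverse (real (Suc n))) w t}" for n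
    by (rule assms) simp
  then have "negligible (\<Union>n. {t \<in> {0..1}. \<not> rate_le (inverse (real (Suc n))) w t})"
    by (intro negligible_countable_Union) blast+
  ultimately show ?thesis by (rule negligible_subset[rotated])
qed

text \<open>Intervals on which \<open>w\<close> exceeds \<epsilon> times the length, taken fine for
  the gauge, form a Vitali cover of the bad set. A disjoint subfamily covers it up to a null set,
  and every finite part of that subfamily is a fine partial partition, so its total length is at
  most 1/\<epsilon> times a small sum of \<open>w\<close>.\<close>

lemma variationally_null_vanishing_rate:
  assumes w: "variationally_null w"
    and nonneg: "\<And>t I. t \<in> {0..1} \<Longrightarrow> I \<in> subintervals \<Longrightarrow> 0 \<le> w t I"
  shows "negligible {t \<in> {0..1}. \<not> vanishing_rate_at w t}"
proof (rule ae_vanishing_rate)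
  fix \<epsilon> :: real assume \<epsilon>: "0 < \<epsilon>"
  define B where "B = {t \<in> {0..1}. \<forall>\<eta>>0. \<exists>a b. 0 \<le> a \<and> a \<le> t \<and> t \<le> b \<and> b \<le> 1 \<and>
      a < b \<and> b - a < \<eta> \<and> \<epsilon> * (b - a) < w t {a..b}}"
  have "negligible B"
    \<comment> \<open>As \<open>w\<close> is arbitrary, \<open>B\<close> may be nonmeasurable; it is
      enclosed in measurable sets of small measure.\<close>
    unfolding negligible_outer_le
  proof (intro allI impI)
    fix e :: real assume e: "0 < e"
    obtain \<delta> where \<delta>: "\<And>t. t \<in> {0..1} \<Longrightarrow> \<delta> t > 0"
      and sums: "\<And>p. p tagged_partial_division_of {0..1} \<Longrightarrow> (\<lambda>t. {t - \<delta> t <..< t + \<delta> t}) fine p \<Longrightarrow>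
         (\<Sum>(t, I)\<in>p. w t I) < \<epsilon> * e"
      using variationally_null_partial[OF w mult_pos_pos[OF \<epsilon> e] nonneg] by blast
    define bad where "bad t a b \<longleftrightarrow> t \<in> B \<and> 0 \<le> a \<and> a \<le> t \<and> t \<le> b \<and> b \<le> 1 \<and> a < b \<and>
        {a..b} \<subseteq> {t - \<delta> t <..< t + \<delta> t} \<and> \<epsilon> * (b - a) < w t {a..b}" for t a b
    define K where "K = {(a, b). \<exists>t. bad t a b}"
    \<comment> \<open>Intervals are recoded by midpoint and half length to fit the covering theorem
      for balls.\<close>
    define c where "c = (\<lambda>(a, b). (a + b) / 2 :: real)"
    define r where "r = (\<lambda>(a, b). (b - a) / 2 :: real)"
    define I where "I = (\<lambda>(a, b). {a..b} :: real set)"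
    have cb: "cball (c i) (r i) = I i" for i
      by (cases i) (auto simp: c_def r_def I_def dist_real_def abs_le_iff field_simps)
    obtain C where C: "countable C" "C \<subseteq> K" "pairwise (\<lambda>i j. disjnt (I i) (I j)) C"
      "negligible (B - (\<Union>i\<in>C. I i))"
    proof (rule Vitali_covering_theorem_cballs[of K r "B" c, unfolded cb])
      show "0 < r i" if "i \<in> K" for i using that by (auto simp: K_def r_def bad_def)
      fix x d :: real assume x: "x \<in> B" and d: "0 < d"
      then have "0 < min d (\<delta> x)" using \<delta> by (auto simp: B_def)
      then obtain a b where ab: "0 \<le> a" "a \<le> x" "x \<le> b" "b \<le> 1" "a < b" "b - a < min d (\<delta> x)"
        "\<epsilon> * (b - a) < w x {a..b}"
        using x unfolding B_def by blast
      then have "bad x a b" using x by (auto simp: bad_def)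
      then have "(a, b) \<in> K" by (auto simp: K_def)
      moreover have "x \<in> I (a, b)" "r (a, b) < d" using ab by (auto simp: I_def r_def)
      ultimately show "\<exists>i. i \<in> K \<and> x \<in> I i \<and> r i < d" by blast
    qed
    define \<tau> where "\<tau> a b = (SOME t. bad t a b)" for a b
    have \<tau>: "bad (\<tau> a b) a b" if "(a, b) \<in> C" for a b
    proof -
      have "\<exists>t. bad t a b" using that C(2) by (auto simp: K_def)
      then show ?thesis unfolding \<tau>_def by (rule someI_ex)
    qed
    have fin: "measure lebesgue (\<Union>i\<in>F. I i) \<le> e" if F: "F \<subseteq> C" "finite F" for F
    proof -
      define g where "g = (\<lambda>(a, b). (\<tau> a b, I (a, b)))"
      have Ff: "bad (\<tau> a b) a b" "a < b" if "(a, b) \<in> F" for a b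
        using that F \<tau> by (auto simp: bad_def)
      have inj: "inj_on g F"
      proof (rule inj_onI)
        fix i j assume "i \<in> F" "j \<in> F" "g i = g j"
        then show "i = j"
          using Ff(2)[of "fst i" "snd i"] Ff(2)[of "fst j" "snd j"]
          by (auto simp: g_def I_def case_prod_unfold Icc_eq_Icc prod_eq_iff)
      qed
      have div: "g ` F tagged_partial_division_of {0..1}"
        unfolding tagged_partial_division_of_def
      proof (intro conjI allI impI)
        show "finite (g ` F)" using F by simp
        show "x \<in> k" "k \<subseteq> {0..1}" "\<exists>a b. k = cbox a b" if "(x, k) \<in> g ` F" for x k
          using that by (auto simp: g_def I_def bad_def dest!: Ff(1))
        fix x1 k1 x2 k2
        assume "(x1, k1) \<in> g ` F \<and> (x2, k2) \<in> g ` F \<and> (x1, k1) \<noteq> (x2, k2)"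
        then obtain i j where "i \<in> F" "j \<in> F" "i \<noteq> j" "k1 = I i" "k2 = I j"
          by (force simp: g_def)
        then have "k1 \<inter> k2 = {}" using C(3) F(1) unfolding pairwise_def disjnt_def by blast
        then show "interior k1 \<inter> interior k2 = {}" using interior_subset by blast
      qed
      have fine: "(\<lambda>t. {t - \<delta> t <..< t + \<delta> t}) fine g ` F"
      proof (rule fineI)
        fix t k assume "(t, k) \<in> g ` F"
        then obtain a b where "(a, b) \<in> F" "t = \<tau> a b" "k = {a..b}" by (auto simp: g_def I_def)
        then show "k \<subseteq> {t - \<delta> t <..< t + \<delta> t}" using Ff(1) unfolding bad_def by blast
      qed
      have "\<epsilon> * (\<Sum>(a, b)\<in>F. b - a) = (\<Sum>(a, b)\<in>F. \<epsilon> * (b - a))"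
        by (simp add: sum_distrib_left case_prod_unfold)
      also have "\<dots> \<le> (\<Sum>(a, b)\<in>F. w (\<tau> a b) {a..b})"
        by (intro sum_mono) (auto simp: bad_def dest!: Ff(1))
      also have "\<dots> = (\<Sum>(t, J)\<in>g ` F. w t J)"
        by (subst sum.reindex[OF inj]) (auto simp: g_def I_def intro!: sum.cong)
      also have "\<dots> < \<epsilon> * e" by (rule sums[OF div fine])
      finally have "(\<Sum>(a, b)\<in>F. b - a) < e" using \<epsilon> by simp
      moreover have "measure lebesgue (\<Union>i\<in>F. I i) \<le> (\<Sum>i\<in>F. measure lebesgue (I i))"
        using F(2) by (intro measure_UNION_le) (auto simp: I_def)
      moreover have "(\<Sum>i\<in>F. measure lebesgue (I i)) = (\<Sum>(a, b)\<in>F. b - a)"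
        using Ff(2) by (intro sum.cong) (auto simp: I_def less_imp_le)
      ultimately show ?thesis by simp
    qed
    have lm: "I i \<in> lmeasurable" for i by (cases i) (auto simp: I_def)
    have U: "(\<Union>i\<in>C. I i) \<in> lmeasurable" "measure lebesgue (\<Union>i\<in>C. I i) \<le> e"
      using fmeasurable_UN_bound[OF C(1) lm fin] measure_UN_bound[OF C(1) lm fin] by auto
    let ?T = "(\<Union>i\<in>C. I i) \<union> (B - (\<Union>i\<in>C. I i))"
    have "?T \<in> lmeasurable" by (rule fmeasurable.Un[OF U(1) negligible_imp_measurable[OF C(4)]])
    moreover have "measure lebesgue ?T \<le> e"
      using measure_Un_le[OF fmeasurableD[OF U(1)] negligible_imp_sets[OF C(4)]] U(2)
        negligible_imp_measure0[OF C(4)] by linarith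
    ultimately show "\<exists>T. B \<subseteq> T \<and> T \<in> lmeasurable \<and> measure lebesgue T \<le> e"
      by (intro exI[of _ ?T]) simp
  qed
  moreover have "{t \<in> {0..1}. \<not> rate_le \<epsilon> w t} = B"
    unfolding B_def rate_le_def not_le[symmetric] by blast
  ultimately show "negligible {t \<in> {0..1}. \<not> rate_le \<epsilon> w t}" by simp
qed

section \<open>Lebesgue density points\<close>

lemma indicator_Compl_has_integral:
  assumes A: "A \<in> sets lebesgue"
  shows "((indicator (- A) :: real \<Rightarrow> real) has_integral measure lebesgue ({a..b} - A)) {a..b}"
proof -
  have "{a..b} - A \<in> lmeasurable" using A by (intro fmeasurable_Diff) auto
  then have "(indicator ({a..b} - A) has_integral measure lebesgue ({a..b} - A)) (UNIV :: real set)"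
    by (simp add: lmeasurable_iff_has_integral)
  moreover have "indicator ({a..b} - A) = (\<lambda>x. if x \<in> {a..b} then indicator (- A) x else (0::real))"
    by (auto simp: indicator_def)
  ultimately show ?thesis by (simp only: has_integral_restrict_UNIV)
qed

text \<open>Henstock's lemma makes the error of the indefinite integral of the indicator of
  \<open>- A\<close> variationally null, so the differentiation lemma applies. At points of
  \<open>A\<close> the indicator vanishes, and this error is exactly the measure of
  \<open>I - A\<close>.\<close>

lemma ae_density_point:
  assumes A: "A \<in> sets lebesgue"
  shows "negligible {t \<in> A \<inter> {0..1}. \<not> vanishing_rate_at (\<lambda>t I. measure lebesgue (I - A)) t}"
proof -
  define f where "f = (indicator (- A) :: real \<Rightarrow> real)"
  define w where "w t I = norm (measure lborel I *\<^sub>R f t - integral I f)" for t I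
  have int: "(f has_integral measure lebesgue ({a..b} - A)) {a..b}" for a b
    unfolding f_def by (rule indicator_Compl_has_integral[OF A])
  have f01: "f integrable_on cbox 0 1" using has_integral_integrable[OF int] by simp
  have "variationally_null w"
    unfolding variationally_null_def
  proof (intro allI impI)
    fix \<epsilon> :: real assume "0 < \<epsilon>"
    obtain \<gamma> where \<gamma>: "gauge \<gamma>" "\<And>p. p tagged_partial_division_of (cbox 0 1) \<Longrightarrow> \<gamma> fine p \<Longrightarrow>
        (\<Sum>(x,k)\<in>p. norm (measure lborel k *\<^sub>R f x - integral k f)) < \<epsilon>"
      using Henstock_lemma[OF f01 \<open>0 < \<epsilon>\<close>] by blast
    have "\<exists>d>0. ball t d \<subseteq> \<gamma> t" for t
      using \<gamma>(1) unfolding gauge_def by (meson open_contains_ball)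
    then obtain \<delta> where \<delta>: "\<And>t. 0 < \<delta> t" "\<And>t. ball t (\<delta> t) \<subseteq> \<gamma> t" by metis
    show "\<exists>\<delta>. (\<forall>t\<in>{0..1}. 0 < \<delta> t) \<and> (\<forall>p. fine_perron_partition \<delta> p \<longrightarrow> (\<Sum>(t, I)\<in>p. w t I) < \<epsilon>)"
    proof (intro exI[of _ \<delta>] conjI ballI allI impI \<delta>(1))
      fix p assume "fine_perron_partition \<delta> p"
      then show "(\<Sum>(t, I)\<in>p. w t I) < \<epsilon>"
        using \<delta>(2) \<gamma>(2)[of p]
        by (fastforce simp: fine_perron_partition_def w_def tagged_division_of_def fine_def ball_eq_greaterThanLessThan)
    qed
  qed
  then have "negligible {t \<in> {0..1}. \<not> vanishing_rate_at w t}"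
    by (rule variationally_null_vanishing_rate) (simp add: w_def)
  moreover have "vanishing_rate_at (\<lambda>t I. measure lebesgue (I - A)) t"
    if t: "t \<in> A" "vanishing_rate_at w t" for t
  proof -
    have "measure lebesgue ({a..b} - A) = w t {a..b}" for a b
      using t(1) integral_unique[OF int[of a b]] by (simp add: w_def f_def)
    then show ?thesis using t(2) unfolding vanishing_rate_at_def rate_le_def by simp
  qed
  ultimately show ?thesis by (auto intro: negligible_subset)
qed

subsection \<open>Countable covers with small oscillation\<close>

text \<open>\<open>P s t\<close> stands for "the values at \<open>s\<close> and \<open>t\<close>
  differ by at most \<open>e\<close>". If this holds for every \<open>e\<close>, the function is
  approximated off null sets by countably valued measurable ones, whatever space its values lie
  in.\<close>

definition osc_cover :: "(real \<Rightarrow> real \<Rightarrow> bool) \<Rightarrow> bool" where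
  "osc_cover P \<longleftrightarrow> (\<exists>\<A>. countable \<A> \<and> \<A> \<subseteq> sets lebesgue \<and> negligible ({0..1} - \<Union>\<A>) \<and>
     (\<forall>A\<in>\<A>. A \<subseteq> {0..1} \<and> (\<forall>s\<in>A. \<forall>t\<in>A. P s t)))"

lemma osc_coverI:
  assumes "countable \<A>" "\<And>A. A \<in> \<A> \<Longrightarrow> A \<in> sets lebesgue" "negligible N" "{0..1} \<subseteq> N \<union> \<Union>\<A>"
    and "\<And>A. A \<in> \<A> \<Longrightarrow> A \<subseteq> {0..1}" "\<And>A s t. A \<in> \<A> \<Longrightarrow> s \<in> A \<Longrightarrow> t \<in> A \<Longrightarrow> P s t"
  shows "osc_cover P"
  unfolding osc_cover_def
proof (intro exI[of _ \<A>] conjI ballI subsetI)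
  show "negligible ({0..1} - \<Union>\<A>)" using assms(3) by (rule negligible_subset) (use assms(4) in blast)
qed (use assms in blast)+

lemma osc_coverE:
  assumes "osc_cover P"
  obtains \<A> where "countable \<A>" "\<And>A. A \<in> \<A> \<Longrightarrow> A \<in> sets lebesgue" "negligible ({0..1} - \<Union>\<A>)"
    "\<And>A. A \<in> \<A> \<Longrightarrow> A \<subseteq> {0..1}" "\<And>A s t. A \<in> \<A> \<Longrightarrow> s \<in> A \<Longrightarrow> t \<in> A \<Longrightarrow> P s t"
proof -
  obtain \<A> where \<A>: "countable \<A> \<and> \<A> \<subseteq> sets lebesgue \<and> negligible ({0..1} - \<Union>\<A>) \<and>
     (\<forall>A\<in>\<A>. A \<subseteq> {0..1} \<and> (\<forall>s\<in>A. \<forall>t\<in>A. P s t))"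
    using assms unfolding osc_cover_def by (elim exE)
  show ?thesis by (rule that[of \<A>]) (use \<A> in simp_all, blast)
qed

lemma osc_cover_mono:
  assumes "osc_cover P" "\<And>s t. P s t \<Longrightarrow> Q s t" shows "osc_cover Q"
  using assms unfolding osc_cover_def by meson

lemma osc_cover_conj:
  assumes "osc_cover P" "osc_cover Q" shows "osc_cover (\<lambda>s t. P s t \<and> Q s t)"
proof -
  obtain \<A> where A: "countable \<A>" "\<And>A. A \<in> \<A> \<Longrightarrow> A \<in> sets lebesgue" "negligible ({0..1} - \<Union>\<A>)"
    "\<And>A. A \<in> \<A> \<Longrightarrow> A \<subseteq> {0..1}" "\<And>A s t. A \<in> \<A> \<Longrightarrow> s \<in> A \<Longrightarrow> t \<in> A \<Longrightarrow> P s t"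
    using assms(1) by (rule osc_coverE) blast
  obtain \<B> where B: "countable \<B>" "\<And>A. A \<in> \<B> \<Longrightarrow> A \<in> sets lebesgue" "negligible ({0..1} - \<Union>\<B>)"
    "\<And>A. A \<in> \<B> \<Longrightarrow> A \<subseteq> {0..1}" "\<And>A s t. A \<in> \<B> \<Longrightarrow> s \<in> A \<Longrightarrow> t \<in> A \<Longrightarrow> Q s t"
    using assms(2) by (rule osc_coverE) blast
  show ?thesis
  proof (rule osc_coverI[of "(\<lambda>(A, B). A \<inter> B) ` (\<A> \<times> \<B>)" "({0..1} - \<Union>\<A>) \<union> ({0..1} - \<Union>\<B>)"])
    show "countable ((\<lambda>(A, B). A \<inter> B) ` (\<A> \<times> \<B>))" using A(1) B(1) by simp
    show "negligible ({0..1} - \<Union> \<A> \<union> ({0..1} - \<Union> \<B>))" using A(3) B(3) by (rule negligible_Un)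
    show "{0..1} \<subseteq> {0..1} - \<Union>\<A> \<union> ({0..1} - \<Union>\<B>) \<union> \<Union>((\<lambda>(A, B). A \<inter> B) ` (\<A> \<times> \<B>))"
      by auto
    fix E assume "E \<in> (\<lambda>(A, B). A \<inter> B) ` (\<A> \<times> \<B>)"
    then obtain A B where E: "A \<in> \<A>" "B \<in> \<B>" "E = A \<inter> B" by blast
    show "E \<in> sets lebesgue" using A(2)[OF E(1)] B(2)[OF E(2)] E(3) by simp
    show "E \<subseteq> {0..1}" using A(4)[OF E(1)] E(3) by blast
    show "P s t \<and> Q s t" if "s \<in> E" "t \<in> E" for s t
      using A(5)[OF E(1)] B(5)[OF E(2)] E(3) that by simp
  qed
qed

text \<open>Up to a null set, \<open>{g < c}\<close> is the union of the pieces, over all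
  precisions, on which \<open>g < c\<close> throughout: a piece around \<open>t\<close> with
  oscillation below \<open>c - g t\<close> is one of them. Completeness of Lebesgue measure absorbs
  the null set.\<close>

lemma osc_cover_measurable:
  fixes g :: "real \<Rightarrow> real"
  assumes g: "\<And>e. 0 < e \<Longrightarrow> osc_cover (\<lambda>s t. dist (g s) (g t) \<le> e)"
  shows "g \<in> borel_measurable (lebesgue_on {0..1})"
proof -
  define good where "good \<A> n \<longleftrightarrow> countable \<A> \<and> \<A> \<subseteq> sets lebesgue \<and> negligible ({0..1} - \<Union>\<A>) \<and>
     (\<forall>A\<in>\<A>. A \<subseteq> {0..1} \<and> (\<forall>s\<in>A. \<forall>t\<in>A. dist (g s) (g t) \<le> inverse (real (Suc n))))" for \<A> n
  have "\<exists>\<A>. good \<A> n" for n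
    using g[of "inverse (real (Suc n))"] unfolding good_def osc_cover_def by simp
  then obtain \<A> where good: "\<And>n. good (\<A> n) n" by metis
  have A: "\<And>n. countable (\<A> n)" "\<And>n. \<A> n \<subseteq> sets lebesgue"
    "\<And>n A. A \<in> \<A> n \<Longrightarrow> A \<subseteq> {0..1}" "\<And>n. negligible ({0..1} - \<Union>(\<A> n))"
    "\<And>n A s t. A \<in> \<A> n \<Longrightarrow> s \<in> A \<Longrightarrow> t \<in> A \<Longrightarrow> dist (g s) (g t) \<le> inverse (real (Suc n))"
    using good unfolding good_def by simp_all
  define N where "N = (\<Union>n. {0..1} - \<Union>(\<A> n))"
  have N: "negligible N" unfolding N_def by (intro negligible_countable_Union) (use A(4) in auto)
  have "{t \<in> {0..1}. g t < c} \<in> sets lebesgue" for c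
  proof -
    define \<B> where "\<B> = {A \<in> (\<Union>n. \<A> n). \<forall>s\<in>A. g s < c}"
    have "countable \<B>" unfolding \<B>_def by (rule countable_subset[of _ "\<Union>n. \<A> n"]) (use A(1) in auto)
    moreover have "\<B> \<subseteq> sets lebesgue" using A(2) by (auto simp: \<B>_def)
    ultimately have "\<Union>\<B> \<in> sets lebesgue" by (rule sets.countable_Union)
    moreover have "negligible (N \<inter> {t \<in> {0..1}. g t < c})" using N by (rule negligible_subset) auto
    moreover have "{t \<in> {0..1}. g t < c} = \<Union>\<B> \<union> (N \<inter> {t \<in> {0..1}. g t < c})"
    proof (intro equalityI subsetI)
      fix t assume t: "t \<in> {t \<in> {0..1}. g t < c}"
      show "t \<in> \<Union>\<B> \<union> (N \<inter> {t \<in> {0..1}. g t < c})"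
      proof (cases "t \<in> N")
        case False
        obtain n where n: "inverse (real (Suc n)) < c - g t" using t reals_Archimedean[of "c - g t"] by auto
        obtain A where At: "A \<in> \<A> n" "t \<in> A" using False t by (auto simp: N_def)
        have "g s < c" if "s \<in> A" for s
          using A(5)[OF At(1) that At(2)] n by (auto simp: dist_real_def abs_le_iff)
        then show ?thesis using At by (auto simp: \<B>_def)
      qed (use t in auto)
    next
      fix t assume "t \<in> \<Union>\<B> \<union> (N \<inter> {t \<in> {0..1}. g t < c})"
      then consider A n where "A \<in> \<A> n" "\<forall>s\<in>A. g s < c" "t \<in> A" | "t \<in> {0..1}" "g t < c"
        by (auto simp: \<B>_def)
      then show "t \<in> {t \<in> {0..1}. g t < c}" using A(3) by cases blast+
    qed
    ultimately show ?thesis using sets.Un[of "\<Union>\<B>" lebesgue "N \<inter> {t \<in> {0..1}. g t < c}"]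
        negligible_imp_sets[of "N \<inter> {t \<in> {0..1}. g t < c}"] by argo
  qed
  then show ?thesis
    unfolding borel_measurable_iff_less by (simp add: sets_restrict_space_iff subset_iff)
qed

lemma osc_cover_functional:
  assumes f: "\<And>e. 0 < e \<Longrightarrow> osc_cover (\<lambda>s t. dist (f s) (f t) \<le> e)"
    and \<phi>: "bounded_linear (\<phi> :: 'a::real_normed_vector \<Rightarrow> real)"
  shows "(\<lambda>t. \<phi> (f t)) \<in> borel_measurable (lebesgue_on {0..1})"
proof (rule osc_cover_measurable)
  fix e :: real assume e: "0 < e"
  obtain K where K: "0 < K" "\<And>x. norm (\<phi> x) \<le> norm x * K" using bounded_linear.pos_bounded[OF \<phi>] by blast
  show "osc_cover (\<lambda>s t. dist (\<phi> (f s)) (\<phi> (f t)) \<le> e)"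
  proof (rule osc_cover_mono[OF f[of "e / K"]])
    fix s t assume "dist (f s) (f t) \<le> e / K"
    then have "dist (f s) (f t) * K \<le> e" using K by (simp add: field_simps)
    moreover have "dist (\<phi> (f s)) (\<phi> (f t)) \<le> dist (f s) (f t) * K"
      using K(2)[of "f s - f t"] \<phi> by (simp add: dist_norm bounded_linear.linear linear_diff)
    ultimately show "dist (\<phi> (f s)) (\<phi> (f t)) \<le> e" by simp
  qed (use e K in auto)
qed

text \<open>The simple functions take only countably many values altogether, so the pieces can be
  indexed by such a value \<open>x\<close> and a time \<open>m\<close> after which the approximants
  stay near \<open>x\<close>; the limit then stays near \<open>x\<close> too.\<close>

lemma strongly_measurable_osc_cover:
  assumes f: "strongly_measurable f" and e: "0 < e"
  shows "osc_cover (\<lambda>s t. dist (f s) (f t) \<le> e)"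
proof -
  obtain s where s: "\<And>n. simple_function (lebesgue_on {0..1}) (s n)"
    "AE t in lebesgue_on {0..1}. (\<lambda>n::nat. s n t) \<longlonglongrightarrow> f t"
    using f unfolding strongly_measurable_def by blast
  obtain N where N: "N \<in> null_sets (lebesgue_on {0..1})" "{t \<in> {0..1}. \<not> (\<lambda>n. s n t) \<longlonglongrightarrow> f t} \<subseteq> N"
    using s(2) by (auto simp: eventually_ae_filter)
  then have negN: "negligible N"
    using null_sets_restrict_space[of "{0..1}" lebesgue N] by (simp add: negligible_iff_null_sets)
  have "finite (s n ` {0..1})" for n using simple_functionD(1)[OF s(1)] by simp
  then have D: "countable (\<Union>n. s n ` {0..1})" by (intro countable_UN) (auto intro: countable_finite)
  define A where "A m x = {t \<in> {0..1} - N. \<forall>n\<ge>m. dist (s n t) x \<le> e / 2}" for m :: nat and x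
  have meas: "A m x \<in> sets lebesgue" for m x
  proof -
    have "s n -` cball x (e / 2) \<inter> {0..1} \<in> sets lebesgue" for n
      using simple_functionD(2)[OF s(1), of n "cball x (e / 2)"] by (simp add: sets_restrict_space_iff)
    moreover have "A m x = ({0..1} - N) \<inter> (\<Inter>n\<in>{m..}. s n -` cball x (e / 2) \<inter> {0..1})"
      by (auto simp: A_def dist_commute)
    moreover have "{0..1} - N \<in> sets lebesgue" using negN by (intro sets.Diff) (auto simp: negligible_imp_sets)
    moreover have "(\<Inter>n\<in>{m..}. s n -` cball x (e / 2) \<inter> {0..1}) \<in> sets lebesgue"
      using calculation(1) by (intro sets.countable_INT') auto
    ultimately show ?thesis by (metis sets.Int)
  qed
  show ?thesis
  proof (rule osc_coverI[of "(\<lambda>(m, x). A m x) ` (UNIV \<times> (\<Union>n. s n ` {0..1}))" N])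
    show "countable ((\<lambda>(m, x). A m x) ` (UNIV \<times> (\<Union>n. s n ` {0..1})))" using D by simp
    show "negligible N" by fact
    show "{0..1} \<subseteq> N \<union> \<Union> ((\<lambda>(m, x). A m x) ` (UNIV \<times> (\<Union>n. s n ` {0..1})))"
    proof
      fix t assume t: "t \<in> {0..1::real}"
      show "t \<in> N \<union> \<Union> ((\<lambda>(m, x). A m x) ` (UNIV \<times> (\<Union>n. s n ` {0..1})))"
      proof (cases "t \<in> N")
        case False
        then have "(\<lambda>n. s n t) \<longlonglongrightarrow> f t" using N(2) t by blast
        then obtain m where m: "\<And>n. n \<ge> m \<Longrightarrow> dist (s n t) (f t) < e / 4"
          using metric_LIMSEQ_D[of _ "f t" "e / 4"] e by auto
        have "dist (s n t) (s m t) \<le> e / 2" if "n \<ge> m" for n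
          using m[OF that] m[of m] dist_triangle2[of "s n t" "s m t" "f t"] by simp
        then have "t \<in> A m (s m t)" using t False by (auto simp: A_def)
        then show ?thesis using t by blast
      qed simp
    qed
    fix B u t assume "B \<in> (\<lambda>(m, x). A m x) ` (UNIV \<times> (\<Union>n. s n ` {0..1}))" "u \<in> B" "t \<in> B"
    then obtain m x where mx: "u \<in> A m x" "t \<in> A m x" by auto
    have "dist (f t) x \<le> e / 2" if "t \<in> A m x" for t
    proof (rule Lim_bounded[OF tendsto_dist[OF _ tendsto_const]])
      show "(\<lambda>n. s n t) \<longlonglongrightarrow> f t" using that N(2) by (auto simp: A_def)
      show "\<forall>n\<ge>m. dist (s n t) x \<le> e / 2" using that by (simp add: A_def)
    qed
    from this[OF mx(1)] this[OF mx(2)] show "dist (f u) (f t) \<le> e"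
      using dist_triangle2[of "f u" "f t" x] by simp
  qed (use meas in \<open>auto simp: A_def\<close>)
qed

text \<open>
  Values are picked successively in the representatives \<open>C n k\<close>, each within the current precision
  of the previous one, so no separability of the values of the multifunction is needed.
\<close>

lemma osc_cover_selection:
  fixes \<Gamma> :: "real \<Rightarrow> 'a::banach set"
  assumes cwk: "\<And>t. t \<in> {0..1} \<Longrightarrow> \<Gamma> t \<in> cwk"
    and cover: "\<And>e. 0 < e \<Longrightarrow> osc_cover (\<lambda>s t. hclose e (\<Gamma> s) (\<Gamma> t))"
  obtains f where "f \<in> selections \<Gamma>" "\<And>e. 0 < e \<Longrightarrow> osc_cover (\<lambda>s t. dist (f s) (f t) \<le> e)"
proof -
  define h where "h n = (1/2::real) ^ n" for n
  have h: "0 < h n" "h (Suc n) = h n / 2" for n by (auto simp: h_def)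
  define good where "good A n \<longleftrightarrow> (\<forall>k. A k \<in> sets lebesgue \<and> A k \<subseteq> {0..1} \<and>
      (\<forall>s\<in>A k. \<forall>t\<in>A k. hclose (h n) (\<Gamma> s) (\<Gamma> t))) \<and> negligible ({0..1} - (\<Union>k::nat. A k))" for A n
  have "\<exists>A. good A n" for n
  proof -
    obtain \<A> where A: "countable \<A>" "\<And>A. A \<in> \<A> \<Longrightarrow> A \<in> sets lebesgue" "negligible ({0..1} - \<Union>\<A>)"
      "\<And>A. A \<in> \<A> \<Longrightarrow> A \<subseteq> {0..1}" "\<And>A s t. A \<in> \<A> \<Longrightarrow> s \<in> A \<Longrightarrow> t \<in> A \<Longrightarrow> hclose (h n) (\<Gamma> s) (\<Gamma> t)"
      using cover[OF h(1)] by (rule osc_coverE) blast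
    define B where "B = from_nat_into (insert {} \<A>)"
    have B: "range B = insert {} \<A>" unfolding B_def using A(1) by (intro range_from_nat_into) auto
    then have "B k = {} \<or> B k \<in> \<A>" for k by blast
    then have "B k \<in> sets lebesgue \<and> B k \<subseteq> {0..1} \<and> (\<forall>s\<in>B k. \<forall>t\<in>B k. hclose (h n) (\<Gamma> s) (\<Gamma> t))" for k
      using A(2,4,5) by (metis empty_iff sets.empty_sets empty_subsetI)
    moreover have "(\<Union>k. B k) = \<Union>\<A>" using B by simp
    ultimately have "good B n" using A(3) by (simp add: good_def)
    then show ?thesis by blast
  qed
  then obtain A where good: "\<And>n. good (A n) n" by metis
  have A: "\<And>n k. A n k \<in> sets lebesgue"
    "\<And>n k. A n k \<subseteq> {0..1}" "\<And>n. negligible ({0..1} - (\<Union>k::nat. A n k))"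
    "\<And>n k s t. s \<in> A n k \<Longrightarrow> t \<in> A n k \<Longrightarrow> hclose (h n) (\<Gamma> s) (\<Gamma> t)"
    using good unfolding good_def by simp_all
  define G where "G = {t \<in> {0..1}. \<forall>n. \<exists>k. t \<in> A n k}"
  \<comment> \<open>The least index makes the pieces disjoint: the set where
    \<open>j n t = k\<close> is, within \<open>G\<close>, the set \<open>A n k\<close> minus its
    predecessors, hence measurable.\<close>
  define j where "j n t = (LEAST k. t \<in> A n k)" for n t
  define C where "C n k = \<Gamma> (SOME t. t \<in> A n k)" for n k
  have j: "t \<in> A n (j n t)" if "t \<in> G" for n t
    using that unfolding G_def j_def by (auto intro: LeastI_ex)
  have C: "hclose (h n) (\<Gamma> t) (C n (j n t))" if "t \<in> G" for n t
    using j[OF that, of n] unfolding C_def by (intro A(4)) (auto intro: someI)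
  have CC: "hclose (2 * h n) (C n (j n t)) (C (Suc n) (j (Suc n) t))" if "t \<in> G" for n t
  proof -
    have "hclose (h n + h (Suc n)) (C n (j n t)) (C (Suc n) (j (Suc n) t))"
      using hclose_trans[OF hclose_sym[OF C[OF that]] C[OF that]] .
    moreover have "h n + h (Suc n) \<le> 2 * h n" using h by (simp add: h_def)
    ultimately show ?thesis unfolding hclose_def by (meson less_le_trans)
  qed
  \<comment> \<open>Each choice depends on \<open>t\<close> only through
    \<open>j 0 t, ..., j n t\<close>, so \<open>x t n\<close> takes countably many values on
    measurable sets. Choosing in \<open>\<Gamma> t\<close> itself would lose this.\<close>
  define x where "x t = rec_nat (SOME y. y \<in> C 0 (j 0 t))
      (\<lambda>n z. SOME y. y \<in> C (Suc n) (j (Suc n) t) \<and> dist z y < 2 * h n)" for t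
  have x0: "x t 0 = (SOME y. y \<in> C 0 (j 0 t))" for t by (simp add: x_def)
  have xS: "x t (Suc n) = (SOME y. y \<in> C (Suc n) (j (Suc n) t) \<and> dist (x t n) y < 2 * h n)" for t n
    by (simp add: x_def)
  have step: "x t (Suc n) \<in> C (Suc n) (j (Suc n) t) \<and> dist (x t n) (x t (Suc n)) < 2 * h n"
    if "t \<in> G" "x t n \<in> C n (j n t)" for t n
  proof -
    have "\<exists>y. y \<in> C (Suc n) (j (Suc n) t) \<and> dist (x t n) y < 2 * h n"
      using CC[OF that(1), of n] that(2) unfolding hclose_def by blast
    then show ?thesis unfolding xS by (rule someI_ex)
  qed
  have xC: "x t n \<in> C n (j n t)" if "t \<in> G" for t n
  proof (induction n)
    case 0
    have "t \<in> {0..1}" using that by (simp add: G_def)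
    then obtain y where "y \<in> \<Gamma> t" using cwkD(1)[OF cwk] by blast
    then have "\<exists>y. y \<in> C 0 (j 0 t)" using C[OF that, of 0] unfolding hclose_def by blast
    then show ?case unfolding x0 by (rule someI_ex)
  qed (use step[OF that] in blast)
  \<comment> \<open>Each step costs less than \<open>2 * h m = 4 * h m - 4 * h (Suc m)\<close>, so
    the bounds telescope.\<close>
  have tail: "dist (x t n) (x t (n + m)) \<le> 4 * h n - 4 * h (n + m)" if "t \<in> G" for t n m
  proof (induction m)
    case (Suc m)
    have "dist (x t n) (x t (n + Suc m)) \<le> dist (x t n) (x t (n + m)) + dist (x t (n + m)) (x t (Suc (n + m)))"
      by (simp add: dist_triangle)
    also have "\<dots> \<le> (4 * h n - 4 * h (n + m)) + 2 * h (n + m)"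
      using Suc step[OF that xC[OF that], of "n + m"] by (intro add_mono) auto
    finally show ?case using h(2)[of "n + m"] by simp
  qed simp
  have hlim: "h \<longlonglongrightarrow> 0" unfolding h_def by (rule LIMSEQ_power_zero) simp
  have small: "\<exists>n. c * h n < e" if "0 < e" "0 < c" for c e :: real
  proof -
    have "0 < e / c" using that by simp
    then obtain n where "norm (h n - 0) < e / c" using LIMSEQ_D[OF hlim] by blast
    then have "c * h n < e" using that h(1)[of n] by (simp add: field_simps)
    then show ?thesis ..
  qed
  \<comment> \<open>Off \<open>G\<close>, which within \<open>{0..1}\<close> is a null set, any
    point of \<open>\<Gamma> t\<close> will do; a selection must be correct at every point.\<close>
  define f where "f t = (if t \<in> G then lim (x t) else SOME y. y \<in> \<Gamma> t)" for t
  have flim: "x t \<longlonglongrightarrow> f t" if t: "t \<in> G" for t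
  proof -
    have "Cauchy (x t)"
    proof (rule metric_CauchyI)
      fix e :: real assume "0 < e"
      then obtain n where n: "8 * h n < e" using small[of e 8] by auto
      have near: "dist (x t n) (x t k) \<le> 4 * h n" if "k \<ge> n" for k
        using tail[OF t, of n "k - n"] that h(1)[of k] by simp
      have "dist (x t k) (x t l) < e" if "k \<ge> n" "l \<ge> n" for k l
        using near[OF that(1)] near[OF that(2)] n dist_triangle3[of "x t k" "x t l" "x t n"] by simp
      then show "\<exists>M. \<forall>m\<ge>M. \<forall>n\<ge>M. dist (x t m) (x t n) < e" by blast
    qed
    then show ?thesis using t by (simp add: f_def Cauchy_convergent_iff convergent_LIMSEQ_iff)
  qed
  have fnear: "dist (x t n) (f t) \<le> 4 * h n" if t: "t \<in> G" for t n
  proof (rule Lim_bounded[OF tendsto_dist[OF tendsto_const flim[OF t]]])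
    show "\<forall>k\<ge>n. dist (x t n) (x t k) \<le> 4 * h n"
    proof (intro allI impI)
      fix k assume "k \<ge> n"
      then show "dist (x t n) (x t k) \<le> 4 * h n" using tail[OF t, of n "k - n"] h(1)[of k] by simp
    qed
  qed
  have "f \<in> selections \<Gamma>"
    unfolding selections_def
  proof (intro CollectI ballI)
    fix t :: real assume t: "t \<in> {0..1}"
    show "f t \<in> \<Gamma> t"
    proof (cases "t \<in> G")
      case True
      show ?thesis
      proof (rule weakly_compact_closed[OF cwkD(3)[OF cwk[OF t]]])
        fix e :: real assume "0 < e"
        \<comment> \<open>\<open>h n\<close> from a point of \<open>\<Gamma> t\<close> to
          \<open>x t n\<close>, and \<open>4 * h n\<close> from there to the limit.\<close>
        then obtain n where n: "5 * h n < e" using small[of e 5] by auto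
        obtain y where y: "y \<in> \<Gamma> t" "dist y (x t n) < h n"
          using C[OF True, of n] xC[OF True, of n] unfolding hclose_def by blast
        have "dist y (f t) < e"
          using dist_triangle[of y "f t" "x t n"] y(2) fnear[OF True, of n] n by simp
        then show "\<exists>y\<in>\<Gamma> t. dist y (f t) < e" using y(1) by blast
      qed
    next
      case False
      then show ?thesis using cwkD(1)[OF cwk[OF t]] by (auto simp: f_def some_in_eq)
    qed
  qed
  moreover have "osc_cover (\<lambda>s t. dist (f s) (f t) \<le> e)" if e: "0 < e" for e
  proof -
    obtain n where n: "8 * h n < e" using small[OF e, of 8] by auto
    have same: "x s m = x t m" if "\<And>i. i \<le> m \<Longrightarrow> j i s = j i t" for s t m
      using that
    proof (induction m)
      case (Suc m)
      have "x s m = x t m" by (rule Suc.IH) (simp add: Suc.prems)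
      then show ?case unfolding xS using Suc.prems by simp
    qed (simp add: x0)
    define N where "N = (\<Union>n. {0..1} - (\<Union>k. A n k))"
    have N: "negligible N" unfolding N_def by (intro negligible_countable_Union) (use A(3) in auto)
    have G: "G = {0..1} - N" by (auto simp: G_def N_def)
    have Gm: "G \<in> sets lebesgue" unfolding G using N by (intro sets.Diff) (auto simp: negligible_imp_sets)
    \<comment> \<open>Indexing by lists makes the family countable; only the entries
      \<open>0, ..., n\<close> matter, and they determine \<open>x t n\<close>.\<close>
    define S where "S l = {t \<in> G. \<forall>i\<le>n. j i t = l ! i}" for l
    have jk: "{t \<in> G. j i t = k} = G \<inter> (A i k - (\<Union>k'<k. A i k'))" for i k
    proof -
      have "j i t = k \<longleftrightarrow> t \<in> A i k \<and> (\<forall>k'<k. t \<notin> A i k')" if "t \<in> G" for t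
        using j[OF that, of i] unfolding j_def by (metis LeastI not_less_Least linorder_neqE_nat)
      then show ?thesis by auto
    qed
    have meas: "S l \<in> sets lebesgue" for l
    proof -
      have "S l = (\<Inter>i\<in>{..n}. {t \<in> G. j i t = l ! i})" by (auto simp: S_def)
      also have "\<dots> \<in> sets lebesgue"
        unfolding jk using Gm A(1) by (intro sets.finite_INT) auto
      finally show ?thesis .
    qed
    show ?thesis
    proof (rule osc_coverI[of "range S" N])
      show "{0..1} \<subseteq> N \<union> \<Union> (range S)"
      proof
        fix t :: real assume "t \<in> {0..1}"
        then have "t \<in> N \<or> t \<in> S (map (\<lambda>i. j i t) [0..<Suc n])"
          unfolding S_def G by (auto simp del: upt_Suc)
        then show "t \<in> N \<union> \<Union> (range S)" by blast
      qed
      fix B s t assume "B \<in> range S" "s \<in> B" "t \<in> B"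
      then obtain l where "s \<in> S l" "t \<in> S l" by auto
      then have st: "s \<in> G" "t \<in> G" "x s n = x t n" using same[of n s t] by (auto simp: S_def)
      show "dist (f s) (f t) \<le> e"
        using fnear[OF st(1), of n] fnear[OF st(2), of n] st(3) n dist_triangle3[of "f s" "f t" "x t n"] by simp
    qed (use N meas in \<open>auto simp: S_def G\<close>)
  qed
  ultimately show ?thesis using that by blast
qed

subsection \<open>Variationally integrable multifunctions\<close>

lemma support_sum:
  fixes S :: "'i \<Rightarrow> 'a::real_normed_vector set"
  assumes "finite F" "\<And>i. i \<in> F \<Longrightarrow> bounded (S i)" "\<And>i. i \<in> F \<Longrightarrow> S i \<noteq> {}"
    and \<phi>: "bounded_linear (\<phi> :: 'a \<Rightarrow> real)"
  shows "bounded (sum S F) \<and> sum S F \<noteq> {} \<and> support \<phi> (sum S F) = (\<Sum>i\<in>F. support \<phi> (S i))"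
  using assms(1-3)
proof (induction F)
  case empty
  then show ?case using \<phi> by (simp add: support_def bounded_linear.linear linear_0 set_zero)
next
  case (insert i F)
  then have IH: "bounded (sum S F)" "sum S F \<noteq> {}" "support \<phi> (sum S F) = (\<Sum>i\<in>F. support \<phi> (S i))"
    by simp_all
  have i: "bounded (S i)" "S i \<noteq> {}" using insert.prems by simp_all
  have "bounded (S i + sum S F)"
    using bounded_plus[OF i(1) IH(1)] by (simp add: set_plus_image)
  moreover have "S i + sum S F \<noteq> {}" using i(2) IH(2) by (auto simp: set_plus_def)
  moreover have "support \<phi> (S i + sum S F) = support \<phi> (S i) + (\<Sum>i\<in>F. support \<phi> (S i))"
    using support_plus[OF i IH(1,2) \<phi>] IH(3) by simp
  ultimately show ?case using insert.hyps by simp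
qed

text \<open>Rational endpoints reduce conditions on all intervals around \<open>t\<close> to
  countably many; clipping to \<open>{0..1}\<close> lets \<open>t\<close> be an endpoint only at
  \<open>0\<close> and \<open>1\<close>.\<close>

lemma rational_interval:
  fixes t d :: real
  assumes "t \<in> {0..1}" "0 < d"
  obtains p q where "p \<in> \<rat>" "q \<in> \<rat>" "0 \<le> p" "p \<le> t" "t \<le> q" "q \<le> 1" "p < q" "q - p < d"
proof -
  obtain r1 where r1: "r1 \<in> \<rat>" "t - d / 2 < r1" "r1 < t"
    using Rats_dense_in_real[of "t - d / 2" t] assms(2) by auto
  obtain r2 where r2: "r2 \<in> \<rat>" "t < r2" "r2 < t + d / 2"
    using Rats_dense_in_real[of t "t + d / 2"] assms(2) by auto
  show ?thesis
    using r1 r2 assms by (intro that[of "max 0 r1" "min 1 r2"]) (auto simp: max_def min_def)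
qed

lemma tagged_division_subinterval:
  assumes ab: "0 \<le> a" "b \<le> 1" and p: "p tagged_division_of {a..b}" and tI: "(t, I) \<in> p"
  shows "t \<in> {0..1}" "I \<in> subintervals"
proof -
  obtain u v where uv: "I = {u..v}" using tagged_division_ofD(4)[OF p tI] by auto
  then have "u \<le> t" "t \<le> v" "{u..v} \<subseteq> {a..b}" using tagged_division_ofD(2,3)[OF p tI] by auto
  then have "u \<le> v" "a \<le> u" "v \<le> b" by auto
  then show "I \<in> subintervals" "t \<in> {0..1}"
    using ab uv \<open>u \<le> t\<close> \<open>t \<le> v\<close> by (auto simp: subintervals_def)
qed

section \<open>The multifunction and its primitive\<close>

locale vH_multifunction =
  fixes \<Gamma> :: "real \<Rightarrow> 'a::banach set" and \<Phi> :: "real set \<Rightarrow> 'a set"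
  assumes cwk: "\<And>t. t \<in> {0..1} \<Longrightarrow> \<Gamma> t \<in> cwk"
    and multimeasure: "interval_multimeasure \<Phi>"
    and null: "variationally_null (\<lambda>t I. hausdorff_dist (\<Phi> I) ((*\<^sub>R) (measure lborel I) ` \<Gamma> t))"
begin

definition err :: "real \<Rightarrow> real set \<Rightarrow> real" where
  "err t I = hausdorff_dist (\<Phi> I) ((*\<^sub>R) (measure lborel I) ` \<Gamma> t)"

lemma err_null: "variationally_null err"
  using null unfolding variationally_null_def err_def .

lemma Gamma: "t \<in> {0..1} \<Longrightarrow> \<Gamma> t \<noteq> {}" "t \<in> {0..1} \<Longrightarrow> bounded (\<Gamma> t)"
  using cwkD[OF cwk] by auto

lemma Phi_cwk: "I \<in> subintervals \<Longrightarrow> \<Phi> I \<in> cwk"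
  using multimeasure by (simp add: interval_multimeasure_def)

lemma Phi: "I \<in> subintervals \<Longrightarrow> \<Phi> I \<noteq> {}" "I \<in> subintervals \<Longrightarrow> bounded (\<Phi> I)"
  using cwkD[OF Phi_cwk] by auto

lemma scaled_Gamma: "t \<in> {0..1} \<Longrightarrow> bounded ((*\<^sub>R) c ` \<Gamma> t)" "t \<in> {0..1} \<Longrightarrow> (*\<^sub>R) c ` \<Gamma> t \<noteq> {}"
  using Gamma bounded_scaling by auto

lemma err_nonneg: "t \<in> {0..1} \<Longrightarrow> I \<in> subintervals \<Longrightarrow> 0 \<le> err t I"
  unfolding err_def by (intro hausdorff_dist_nonneg Phi scaled_Gamma)

lemma hclose_err:
  assumes "t \<in> {0..1}" "I \<in> subintervals" "err t I < e"
  shows "hclose e (\<Phi> I) ((*\<^sub>R) (measure lborel I) ` \<Gamma> t)"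
  using assms by (intro hausdorff_dist_less_imp_hclose Phi scaled_Gamma) (auto simp: err_def)

lemma support_err:
  assumes t: "t \<in> {0..1}" and I: "I \<in> subintervals" and K: "0 \<le> K"
    and \<phi>: "bounded_linear (\<phi> :: 'a \<Rightarrow> real)" "\<And>y. \<bar>\<phi> y\<bar> \<le> K * norm y"
  shows "\<bar>support \<phi> (\<Phi> I) - measure lborel I * support \<phi> (\<Gamma> t)\<bar> \<le> K * err t I"
  using support_hausdorff_dist[OF Phi(2)[OF I] scaled_Gamma(1)[OF t, of "measure lborel I"] Phi(1)[OF I]
      scaled_Gamma(2)[OF t] K \<phi>]
    support_scaleR[OF Gamma(2)[OF t] Gamma(1)[OF t] _ \<phi>(1), of "measure lborel I"]
  by (simp add: err_def)

lemma Phi_Un: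
  "I \<in> subintervals \<Longrightarrow> J \<in> subintervals \<Longrightarrow> interior I \<inter> interior J = {} \<Longrightarrow> I \<union> J \<in> subintervals \<Longrightarrow>
     \<Phi> (I \<union> J) = \<Phi> I + \<Phi> J"
  using multimeasure by (simp add: interval_multimeasure_def additive_interval_function_def)

text \<open>Additivity gives \<open>\<Phi> I = \<Phi> I + \<Phi> I\<close>; support functions turn
  this into an equation between reals, where cancellation is allowed. The \<open>0\<close> here is
  the set containing only the zero vector.\<close>

lemma Phi_degenerate:
  assumes "I \<in> subintervals" "interior I = {}"
  shows "\<Phi> I = 0"
proof -
  have double: "\<Phi> I = \<Phi> I + \<Phi> I" using Phi_Un[of I I] assms by simp
  have zero: "support \<phi> (\<Phi> I) = 0" if "bounded_linear \<phi>" for \<phi> :: "'a \<Rightarrow> real"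
    using support_plus[OF Phi(2,1)[OF assms(1)] Phi(2,1)[OF assms(1)] that] double by simp
  have "x = 0" if x: "x \<in> \<Phi> I" for x
  proof (rule functionals_separate)
    fix \<phi> :: "'a \<Rightarrow> real" assume \<phi>: "bounded_linear \<phi>"
    have "bounded_linear (\<lambda>y. - \<phi> y)" using \<phi> by (rule bounded_linear_minus)
    from support_upper[OF Phi(2)[OF assms(1)] this x] support_upper[OF Phi(2)[OF assms(1)] \<phi> x]
    have "\<phi> x = 0" using zero[OF \<phi>] zero[OF bounded_linear_minus[OF \<phi>]] by simp
    then show "\<phi> x = \<phi> 0" using \<phi> by (simp add: bounded_linear.linear linear_0)
  qed
  then show ?thesis using Phi(1)[OF assms(1)] by (auto simp: set_zero)
qed

lemma Phi_sum_tagged_division: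
  assumes ab: "0 \<le> a" "a \<le> b" "b \<le> 1" and p: "p tagged_division_of {a..b}"
  shows "(\<Sum>(t, I)\<in>p. \<Phi> I) = \<Phi> {a..b}"
proof -
  \<comment> \<open>The library sums operative functions of all real intervals, so
    \<open>\<Phi>\<close> is extended by intersecting with \<open>{0..1}\<close>, with the neutral
    set for degenerate intersections.\<close>
  define g where "g I = (if interior (I \<inter> {0..1}) = {} then 0 else \<Phi> (I \<inter> {0..1}))" for I
  have g: "g {u..v} = (if min v 1 \<le> max u 0 then 0 else \<Phi> {max u 0..min v 1})" for u v
    by (simp add: g_def Int_atLeastAtMost interior_atLeastAtMost_real)
  have "operative_real (+) 0 g"
  proof
    show "g {u..v} = 0" if "v \<le> u" for u v
      using that by (simp add: g min_le_iff_disj le_max_iff_disj)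
    show "g {u..c} + g {c..v} = g {u..v}" if "u < c" "c < v" for u v c
    proof (cases "0 < c \<and> c < 1")
      case True
      have "{max u 0..c} \<in> subintervals" "{c..min v 1} \<in> subintervals"
        "{max u 0..c} \<union> {c..min v 1} = {max u 0..min v 1}" "{max u 0..min v 1} \<in> subintervals"
        using True that by (auto simp: subintervals_def)
      then have "\<Phi> {max u 0..min v 1} = \<Phi> {max u 0..c} + \<Phi> {c..min v 1}"
        using Phi_Un[of "{max u 0..c}" "{c..min v 1}"] by (auto simp: interior_atLeastAtMost_real)
      moreover have "\<not> min v 1 \<le> max u 0" "\<not> c \<le> max u 0" "\<not> min v 1 \<le> c" "min c 1 = c" "max c 0 = c"
        using True that by auto
      ultimately show ?thesis by (simp only: g if_False)
    next
      case False
      then show ?thesis using that by (auto simp: g)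
    qed
  qed
  then interpret operative_real "(+)" 0 g
    rewrites "comm_monoid_set.F (+) 0 = sum" by (simp_all add: sum_def)
  have eq: "g I = \<Phi> I" if "I \<in> subintervals" for I
  proof -
    have "I \<inter> {0..1} = I" using that by (auto simp: subintervals_def)
    then show ?thesis using Phi_degenerate[OF that] by (simp add: g_def)
  qed
  have sub: "I \<in> subintervals" if tI: "(t, I) \<in> p" for t I
  proof -
    obtain u v where uv: "I = {u..v}" using tagged_division_ofD(4)[OF p tI] by auto
    then have "u \<le> v" "a \<le> u" "v \<le> b" using tagged_division_ofD(2,3)[OF p tI] by auto
    then show ?thesis using ab uv by (auto simp: subintervals_def)
  qed
  have "(\<Sum>(t, I)\<in>p. \<Phi> I) = (\<Sum>(t, I)\<in>p. g I)" using sub eq by (intro sum.cong) auto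
  also have "\<dots> = g {a..b}" using tagged_division[of p a b] p by simp
  also have "\<dots> = \<Phi> {a..b}" using ab by (intro eq) (auto simp: subintervals_def)
  finally show ?thesis .
qed

text \<open>The same gauge serves all subintervals, since fine partial partitions extend to \<open>{0..1}\<close>.\<close>

lemma err_gauge:
  assumes e: "0 < e"
  obtains \<gamma> where "gauge \<gamma>"
    "\<And>a b p. 0 \<le> a \<Longrightarrow> b \<le> 1 \<Longrightarrow> p tagged_division_of {a..b} \<Longrightarrow> \<gamma> fine p \<Longrightarrow> (\<Sum>(t, I)\<in>p. err t I) < e"
proof -
  obtain \<delta> where \<delta>: "\<And>t. t \<in> {0..1} \<Longrightarrow> \<delta> t > 0"
    "\<And>p. p tagged_partial_division_of {0..1} \<Longrightarrow> (\<lambda>t. {t - \<delta> t <..< t + \<delta> t}) fine p \<Longrightarrow>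
       (\<Sum>(t, I)\<in>p. err t I) < e"
    using variationally_null_partial[OF err_null e err_nonneg] by blast
  define \<gamma> where "\<gamma> t = (if t \<in> {0..1} then {t - \<delta> t <..< t + \<delta> t} else UNIV)" for t :: real
  have "gauge \<gamma>" using \<delta>(1) by (auto simp: gauge_def \<gamma>_def)
  moreover have "(\<Sum>(t, I)\<in>p. err t I) < e"
    if "0 \<le> a" "b \<le> 1" and p: "p tagged_division_of {a..b}" "\<gamma> fine p" for a b p
  proof (rule \<delta>(2))
    have ab: "{a..b} \<subseteq> {0..1}" using that(1,2) by auto
    show part: "p tagged_partial_division_of {0..1}"
      using p(1) ab unfolding tagged_division_of_def tagged_partial_division_of_def
      by (meson order_trans)
    show "(\<lambda>t. {t - \<delta> t <..< t + \<delta> t}) fine p"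
    proof (rule fineI)
      fix t I assume tI: "(t, I) \<in> p"
      have "t \<in> {0..1}" using tagged_partial_division_subintervals(1)[OF part tI] .
      then show "I \<subseteq> {t - \<delta> t <..< t + \<delta> t}" using fineD[OF p(2) tI] by (simp add: \<gamma>_def)
    qed
  qed
  ultimately show ?thesis by (rule that)
qed

text \<open>Support functions turn Minkowski sums into sums of reals, so the error of a Riemann sum
  splits over the partition into terms of size at most \<open>K * err t I\<close>.\<close>

lemma support_Gamma_has_integral:
  assumes ab: "0 \<le> a" "a \<le> b" "b \<le> 1" and \<phi>: "bounded_linear (\<phi> :: 'a \<Rightarrow> real)"
  shows "((\<lambda>t. support \<phi> (\<Gamma> t)) has_integral support \<phi> (\<Phi> {a..b})) {a..b}"
proof -
  obtain K where K: "0 < K" "\<And>x. norm (\<phi> x) \<le> norm x * K" using bounded_linear.pos_bounded[OF \<phi>] by blast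
  then have K': "0 \<le> K" "\<And>x. \<bar>\<phi> x\<bar> \<le> K * norm x" by (simp_all add: mult.commute)
  have "\<exists>\<gamma>. gauge \<gamma> \<and> (\<forall>p. p tagged_division_of cbox a b \<and> \<gamma> fine p \<longrightarrow>
      norm ((\<Sum>(t, I)\<in>p. measure lborel I *\<^sub>R support \<phi> (\<Gamma> t)) - support \<phi> (\<Phi> {a..b})) < e)" if e: "0 < e" for e
  proof -
    obtain \<gamma> where \<gamma>: "gauge \<gamma>" "\<And>a b p. 0 \<le> a \<Longrightarrow> b \<le> 1 \<Longrightarrow> p tagged_division_of {a..b} \<Longrightarrow> \<gamma> fine p \<Longrightarrow>
        (\<Sum>(t, I)\<in>p. err t I) < e / K"
      using err_gauge[of "e / K"] e K(1) by (metis divide_pos_pos)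
    have "norm ((\<Sum>(t, I)\<in>p. measure lborel I *\<^sub>R support \<phi> (\<Gamma> t)) - support \<phi> (\<Phi> {a..b})) < e"
      if p: "p tagged_division_of {a..b}" "\<gamma> fine p" for p
    proof -
      note sub = tagged_division_subinterval[OF ab(1,3) p(1)]
      have fin: "finite p" using p(1) by blast
      have "support \<phi> (\<Phi> {a..b}) = (\<Sum>(t, I)\<in>p. support \<phi> (\<Phi> I))"
      proof -
        have "\<Phi> (snd i) \<noteq> {}" "bounded (\<Phi> (snd i))" if "i \<in> p" for i
          using Phi sub(2)[of "fst i" "snd i"] that by auto
        then show ?thesis
          using support_sum[OF fin _ _ \<phi>, of "\<lambda>i. \<Phi> (snd i)"] Phi_sum_tagged_division[OF ab p(1)]
          by (simp add: case_prod_unfold)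
      qed
      then have "norm ((\<Sum>(t, I)\<in>p. measure lborel I *\<^sub>R support \<phi> (\<Gamma> t)) - support \<phi> (\<Phi> {a..b})) =
          \<bar>\<Sum>(t, I)\<in>p. support \<phi> (\<Phi> I) - measure lborel I * support \<phi> (\<Gamma> t)\<bar>"
        by (simp add: sum_subtractf case_prod_unfold abs_minus_commute)
      also have "\<dots> \<le> (\<Sum>(t, I)\<in>p. K * err t I)"
        using support_err[OF sub K'(1) \<phi> K'(2)] by (intro order_trans[OF sum_abs] sum_mono) auto
      also have "\<dots> = K * (\<Sum>(t, I)\<in>p. err t I)" by (simp add: sum_distrib_left case_prod_unfold)
      also have "\<dots> < e" using \<gamma>(2)[OF ab(1,3) p] K(1) by (simp add: field_simps)
      finally show ?thesis .
    qed
    then show ?thesis using \<gamma>(1) by auto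
  qed
  then have "((\<lambda>t. support \<phi> (\<Gamma> t)) has_integral support \<phi> (\<Phi> {a..b})) (cbox a b)"
    unfolding has_integral by blast
  then show ?thesis by simp
qed

lemma ae_err_vanishing_rate:
  "negligible {t \<in> {0..1}. \<not> vanishing_rate_at err t}"
  by (rule variationally_null_vanishing_rate[OF err_null err_nonneg])

definition quotient :: "real \<Rightarrow> real \<Rightarrow> 'a set" where
  "quotient a b = (*\<^sub>R) (1 / (b - a)) ` \<Phi> {a..b}"

lemma quotient_hclose:
  assumes t: "t \<in> {0..1}" "vanishing_rate_at err t" and e: "0 < e"
  obtains \<eta> where "0 < \<eta>"
    "\<And>a b. 0 \<le> a \<Longrightarrow> a \<le> t \<Longrightarrow> t \<le> b \<Longrightarrow> b \<le> 1 \<Longrightarrow> a < b \<Longrightarrow> b - a < \<eta> \<Longrightarrow> hclose e (quotient a b) (\<Gamma> t)"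
proof -
  \<comment> \<open>Half of \<open>e\<close> leaves room for the strict inequality in
    \<open>hclose\<close>.\<close>
  have "rate_le (e / 2) err t" using t(2) e by (simp add: vanishing_rate_at_def)
  then obtain \<eta> where \<eta>: "0 < \<eta>" "\<And>a b. 0 \<le> a \<and> a \<le> t \<and> t \<le> b \<and> b \<le> 1 \<and> a < b \<and> b - a < \<eta> \<Longrightarrow>
      err t {a..b} \<le> e / 2 * (b - a)"
    unfolding rate_le_def by blast
  have "hclose e (quotient a b) (\<Gamma> t)"
    if ab: "0 \<le> a" "a \<le> t" "t \<le> b" "b \<le> 1" "a < b" "b - a < \<eta>" for a b
  proof -
    have "e / 2 * (b - a) < e * (b - a)" using e ab by simp
    then have "err t {a..b} < e * (b - a)" using \<eta>(2)[of a b] ab by simp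
    then have "hclose (e * (b - a)) (\<Phi> {a..b}) ((*\<^sub>R) (measure lborel {a..b}) ` \<Gamma> t)"
      using ab by (intro hclose_err t(1)) (auto simp: subintervals_def)
    from hclose_scaleR[OF this, of "1 / (b - a)"] show ?thesis
      using ab by (simp add: quotient_def image_image)
  qed
  then show ?thesis using \<eta>(1) that by blast
qed

text \<open>The sets \<open>\<Gamma> t\<close> are compared only through quotients of
  \<open>\<Phi>\<close> over rational intervals. A piece consists of the points of
  \<open>{p..q}\<close> around which all short rational intervals have quotients close to that of
  \<open>{p..q}\<close>; shrinking them to \<open>t\<close> shows \<open>\<Gamma> t\<close> close to
  one common set.\<close>

lemma osc_cover_Gamma:
  assumes e: "0 < e"
  shows "osc_cover (\<lambda>s t. hclose e (\<Gamma> s) (\<Gamma> t))"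
proof -
  define N where "N = {t \<in> {0..1}. \<not> vanishing_rate_at err t}"
  have N: "negligible N" unfolding N_def by (rule ae_err_vanishing_rate)
  define far where "far p q n = {(u, v). u \<in> \<rat> \<and> v \<in> \<rat> \<and> 0 \<le> u \<and> u < v \<and> v \<le> 1 \<and> v - u < inverse (real (Suc n)) \<and>
      \<not> hclose (e / 4) (quotient p q) (quotient u v)}" for p q n
  \<comment> \<open>Measurability comes from removing only countably many intervals, besides the
    null set.\<close>
  define A where "A = (\<lambda>(p, q, n). ({p..q} \<inter> {0..1} - N) - (\<Union>(u, v)\<in>far p q n. {u..v}))"
  have near: "hclose (e / 2) (quotient p q) (\<Gamma> t)" if t: "t \<in> A (p, q, n)" for t p q n
  proof -
    have t01: "t \<in> {0..1}" "vanishing_rate_at err t" using t by (auto simp: A_def N_def)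
    obtain \<eta> where \<eta>: "0 < \<eta>" "\<And>a b. 0 \<le> a \<Longrightarrow> a \<le> t \<Longrightarrow> t \<le> b \<Longrightarrow> b \<le> 1 \<Longrightarrow> a < b \<Longrightarrow> b - a < \<eta> \<Longrightarrow>
        hclose (e / 4) (quotient a b) (\<Gamma> t)"
      using quotient_hclose[OF t01, of "e / 4"] e by auto
    have "0 < min \<eta> (inverse (real (Suc n)))" using \<eta>(1) by simp
    then obtain u v where uv: "u \<in> \<rat>" "v \<in> \<rat>" "0 \<le> u" "u \<le> t" "t \<le> v" "v \<le> 1" "u < v"
      "v - u < min \<eta> (inverse (real (Suc n)))"
      using rational_interval[OF t01(1)] by blast
    have "(u, v) \<notin> far p q n" using t uv by (auto simp: A_def)
    then have "hclose (e / 4) (quotient p q) (quotient u v)" using uv by (auto simp: far_def)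
    from hclose_trans[OF this \<eta>(2)[of u v]] uv show ?thesis by simp
  qed
  show ?thesis
  proof (rule osc_coverI[of "A ` (\<rat> \<times> \<rat> \<times> UNIV)" N])
    show "countable (A ` (\<rat> \<times> \<rat> \<times> UNIV))"
      using countable_rat by (intro countable_image countable_SIGMA) auto
    show "negligible N" by (rule N)
    show "{0..1} \<subseteq> N \<union> \<Union> (A ` (\<rat> \<times> \<rat> \<times> UNIV))"
    proof
      fix t :: real assume t: "t \<in> {0..1}"
      show "t \<in> N \<union> \<Union> (A ` (\<rat> \<times> \<rat> \<times> UNIV))"
      proof (cases "t \<in> N")
        case False
        then have "vanishing_rate_at err t" using t by (simp add: N_def)
        then obtain \<eta> where \<eta>: "0 < \<eta>" "\<And>a b. 0 \<le> a \<Longrightarrow> a \<le> t \<Longrightarrow> t \<le> b \<Longrightarrow> b \<le> 1 \<Longrightarrow> a < b \<Longrightarrow> b - a < \<eta> \<Longrightarrow>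
            hclose (e / 8) (quotient a b) (\<Gamma> t)"
          using quotient_hclose[OF t, of "e / 8"] e by auto
        obtain n where n: "inverse (real (Suc n)) < \<eta>" using reals_Archimedean[OF \<eta>(1)] by blast
        obtain p q where pq: "p \<in> \<rat>" "q \<in> \<rat>" "0 \<le> p" "p \<le> t" "t \<le> q" "q \<le> 1" "p < q" "q - p < \<eta>"
          using rational_interval[OF t \<eta>(1)] by blast
        have "hclose (e / 4) (quotient p q) (quotient u v)"
          if "0 \<le> u" "u \<le> t" "t \<le> v" "v \<le> 1" "u < v" "v - u < inverse (real (Suc n))" for u v
          using hclose_trans[OF \<eta>(2)[of p q] hclose_sym[OF \<eta>(2)[of u v]]] that pq n by simp
        then have "t \<in> A (p, q, n)" using False t pq by (auto simp: A_def far_def)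
        then show ?thesis using pq by blast
      qed simp
    qed
    fix B assume "B \<in> A ` (\<rat> \<times> \<rat> \<times> UNIV)"
    then obtain p q n where B: "B = A (p, q, n)" by auto
    have "countable (far p q n)"
      by (rule countable_subset[of _ "\<rat> \<times> \<rat>"]) (auto simp: far_def countable_rat)
    then have "(\<Union>(u, v)\<in>far p q n. {u..v}) \<in> sets lebesgue"
      by (intro sets.countable_UN') auto
    then show "B \<in> sets lebesgue"
      unfolding B A_def prod.case using negligible_imp_sets[OF N] by (intro sets.Diff sets.Int) auto
    show "B \<subseteq> {0..1}" by (auto simp: B A_def)
    show "hclose e (\<Gamma> s) (\<Gamma> t)" if "s \<in> B" "t \<in> B" for s t
      using hclose_trans[OF hclose_sym[OF near] near] that unfolding B by fastforce
  qed
qed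

end

section \<open>Selections of small oscillation: weak primitive and its derivative in norm\<close>

locale vH_selection = vH_multifunction \<Gamma> \<Phi>
  for \<Gamma> :: "real \<Rightarrow> 'a::banach set" and \<Phi> +
  fixes f :: "real \<Rightarrow> 'a"
  assumes selection: "f \<in> selections \<Gamma>"
    and cover: "\<And>e. 0 < e \<Longrightarrow> osc_cover (\<lambda>s t. dist (f s) (f t) \<le> e)"
begin

lemma f_in: "t \<in> {0..1} \<Longrightarrow> f t \<in> \<Gamma> t"
  using selection by (simp add: selections_def)

definition gap :: "('a \<Rightarrow> real) \<Rightarrow> real \<Rightarrow> real" where
  "gap \<phi> t = support \<phi> (\<Gamma> t) - \<phi> (f t)"

lemma gap_nonneg:
  assumes "t \<in> {0..1}" "bounded_linear \<phi>" shows "0 \<le> gap \<phi> t"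
  using support_upper[OF Gamma(2)[OF assms(1)] assms(2) f_in[OF assms(1)]] by (simp add: gap_def)

text \<open>\<open>\<phi> \<circ> f\<close> itself may have no absolutely integrable bound, but
  \<open>gap \<phi>\<close> is measurable and lies between \<open>0\<close> and the width of
  \<open>\<Gamma> t\<close> in direction \<phi>, a sum of two integrable support functions.\<close>

lemma functional_integrable:
  assumes ab: "0 \<le> a" "b \<le> 1" and \<phi>: "bounded_linear (\<phi> :: 'a \<Rightarrow> real)"
  shows "(\<lambda>t. \<phi> (f t)) integrable_on {a..b}"
proof -
  have \<phi>': "bounded_linear (\<lambda>x. - \<phi> x)" using \<phi> by (rule bounded_linear_minus)
  have int: "(\<lambda>t. support \<psi> (\<Gamma> t)) integrable_on {0..1}" if "bounded_linear \<psi>" for \<psi> :: "'a \<Rightarrow> real"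
    using support_Gamma_has_integral[OF _ _ _ that, of 0 1] by (auto intro: has_integral_integrable)
  have "gap \<phi> integrable_on {0..1}"
  proof (rule measurable_bounded_by_integrable_imp_integrable)
    show "gap \<phi> \<in> borel_measurable (lebesgue_on {0..1})"
      unfolding gap_def using integrable_imp_measurable[OF int[OF \<phi>]] osc_cover_functional[OF cover \<phi>]
      by (intro borel_measurable_diff) auto
    show "(\<lambda>t. support \<phi> (\<Gamma> t) + support (\<lambda>x. - \<phi> x) (\<Gamma> t)) integrable_on {0..1}"
      by (intro integrable_add int \<phi> \<phi>')
    show "norm (gap \<phi> t) \<le> support \<phi> (\<Gamma> t) + support (\<lambda>x. - \<phi> x) (\<Gamma> t)" if "t \<in> {0..1}" for t
      using gap_nonneg[OF that \<phi>] support_upper[OF Gamma(2)[OF that] \<phi>' f_in[OF that]]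
      by (simp add: gap_def)
  qed auto
  then have "(\<lambda>t. support \<phi> (\<Gamma> t) - gap \<phi> t) integrable_on {0..1}"
    by (intro integrable_diff int[OF \<phi>])
  then have "(\<lambda>t. \<phi> (f t)) integrable_on {0..1}" by (simp add: gap_def)
  then show ?thesis by (rule integrable_on_subinterval) (use ab in auto)
qed

text \<open>
  The integrals of all \<open>\<phi> \<circ> f\<close> are represented by one point of \<open>\<Phi> {a..b}\<close>: a Riemann sum of \<open>f\<close> that is
  good for finitely many functionals and for \<open>\<Gamma>\<close> is close to such a point, and \<open>\<Phi> {a..b}\<close> is weakly
  compact.
\<close>

lemma weak_integral_exists:
  assumes ab: "0 \<le> a" "a \<le> b" "b \<le> 1"
  shows "\<exists>x\<in>\<Phi> {a..b}. \<forall>\<phi> :: 'a \<Rightarrow> real. bounded_linear \<phi> \<longrightarrow> \<phi> x = integral {a..b} (\<lambda>t. \<phi> (f t))"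
proof (rule weakly_compact_represents)
  have "{a..b} \<in> subintervals" using ab by (auto simp: subintervals_def)
  then show "compactin weak_topology (\<Phi> {a..b})" by (intro cwkD Phi_cwk)
  fix S :: "('a \<Rightarrow> real) set" and e :: real
  assume S: "finite S" "\<And>\<phi>. \<phi> \<in> S \<Longrightarrow> bounded_linear \<phi>" and e: "0 < e"
  have "\<exists>K>0. \<forall>x. norm (\<phi> x) \<le> norm x * K" if "\<phi> \<in> S" for \<phi>
    using bounded_linear.pos_bounded[OF S(2)[OF that]] .
  then obtain k where k: "\<And>\<phi>. \<phi> \<in> S \<Longrightarrow> 0 < k \<phi>" "\<And>\<phi> x. \<phi> \<in> S \<Longrightarrow> norm (\<phi> x) \<le> norm x * k \<phi>"
    by metis
  \<comment> \<open>A common bound for the functionals in \<open>S\<close>, positive even if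
    \<open>S\<close> is empty.\<close>
  define K where "K = 1 + sum k S"
  have k_le: "k \<phi> \<le> K" if "\<phi> \<in> S" for \<phi>
    using member_le_sum[OF that _ S(1), of k] k(1) unfolding K_def by (simp add: less_imp_le)
  have K: "0 < K" using k(1) by (simp add: K_def sum_nonneg add_pos_nonneg less_imp_le)
  have KS: "\<bar>\<phi> x\<bar> \<le> K * norm x" if "\<phi> \<in> S" for \<phi> x
    using k(2)[OF that, of x] mult_left_mono[OF k_le[OF that] norm_ge_zero[of x]] by (simp add: mult.commute)
  define d where "d = e / (4 * K)"
  have d: "0 < d" "K * (2 * d) = e / 2" using e K by (auto simp: d_def)
  obtain \<gamma>0 where \<gamma>0: "gauge \<gamma>0"
    "\<And>a b p. 0 \<le> a \<Longrightarrow> b \<le> 1 \<Longrightarrow> p tagged_division_of {a..b} \<Longrightarrow> \<gamma>0 fine p \<Longrightarrow> (\<Sum>(t, I)\<in>p. err t I) < d"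
    using err_gauge[OF d(1)] by blast
  have "\<exists>\<gamma>. gauge \<gamma> \<and> (\<forall>p. p tagged_division_of {a..b} \<and> \<gamma> fine p \<longrightarrow>
      norm ((\<Sum>(t, I)\<in>p. measure lborel I *\<^sub>R \<phi> (f t)) - integral {a..b} (\<lambda>t. \<phi> (f t))) < e / 2)"
    if "\<phi> \<in> S" for \<phi>
    using integrable_integral[OF functional_integrable[OF ab(1,3) S(2)[OF that]]] half_gt_zero[OF e]
    unfolding has_integral_real by blast
  then obtain \<gamma> where \<gamma>: "\<And>\<phi>. \<phi> \<in> S \<Longrightarrow> gauge (\<gamma> \<phi>)"
    "\<And>\<phi> p. \<phi> \<in> S \<Longrightarrow> p tagged_division_of {a..b} \<Longrightarrow> \<gamma> \<phi> fine p \<Longrightarrow>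
      norm ((\<Sum>(t, I)\<in>p. measure lborel I *\<^sub>R \<phi> (f t)) - integral {a..b} (\<lambda>t. \<phi> (f t))) < e / 2"
    by metis
  have "gauge (\<lambda>t. \<gamma>0 t \<inter> \<Inter>{\<gamma> \<phi> t |\<phi>. \<phi> \<in> S})"
    by (intro gauge_Int \<gamma>0(1) gauge_Inter S(1) \<gamma>(1))
  then obtain p where p: "p tagged_division_of {a..b}" "(\<lambda>t. \<gamma>0 t \<inter> \<Inter>{\<gamma> \<phi> t |\<phi>. \<phi> \<in> S}) fine p"
    using fine_division_exists_real by blast
  have fine: "\<gamma>0 fine p" "\<And>\<phi>. \<phi> \<in> S \<Longrightarrow> \<gamma> \<phi> fine p"
    using p(2) by (auto simp: fine_def) blast
  note sub = tagged_division_subinterval[OF ab(1,3) p(1)]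
  have fin: "finite p" using p(1) by blast
  \<comment> \<open>Slack for the strict \<open>hclose\<close> in each piece of \<open>p\<close>, at
    most \<open>d\<close> in total.\<close>
  define c where "c = d / (real (card p) + 1)"
  have c: "0 < c" "real (card p) * c \<le> d" using d(1) by (auto simp: c_def field_simps)
  have "\<exists>x\<in>\<Phi> (snd i). dist x (measure lborel (snd i) *\<^sub>R f (fst i)) < err (fst i) (snd i) + c" if i: "i \<in> p" for i
  proof -
    have ti: "fst i \<in> {0..1}" "snd i \<in> subintervals" using sub[of "fst i" "snd i"] i by auto
    then show ?thesis using hclose_err[OF ti, of "err (fst i) (snd i) + c"] c(1) f_in[OF ti(1)]
      by (simp add: hclose_def)
  qed
  then obtain x where x: "\<And>i. i \<in> p \<Longrightarrow> x i \<in> \<Phi> (snd i)"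
    "\<And>i. i \<in> p \<Longrightarrow> dist (x i) (measure lborel (snd i) *\<^sub>R f (fst i)) < err (fst i) (snd i) + c"
    by metis
  define R where "R = (\<Sum>i\<in>p. measure lborel (snd i) *\<^sub>R f (fst i))"
  have "norm (sum x p - R) \<le> (\<Sum>i\<in>p. err (fst i) (snd i) + c)"
    unfolding R_def sum_subtractf[symmetric] using x(2)
    by (intro sum_norm_le) (simp add: dist_norm less_imp_le)
  also have "\<dots> = (\<Sum>(t, I)\<in>p. err t I) + real (card p) * c" by (simp add: sum.distrib case_prod_unfold)
  also have "\<dots> \<le> 2 * d" using \<gamma>0(2)[OF ab(1,3) p(1) fine(1)] c(2) by simp
  finally have near: "norm (sum x p - R) \<le> 2 * d" .
  have "sum x p \<in> (\<Sum>i\<in>p. \<Phi> (snd i))" using set_sum_alt[OF fin] x(1) by blast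
  then have "sum x p \<in> \<Phi> {a..b}" using Phi_sum_tagged_division[OF ab p(1)] by (simp add: case_prod_unfold)
  moreover have "\<bar>\<phi> (sum x p) - integral {a..b} (\<lambda>t. \<phi> (f t))\<bar> \<le> e" if \<phi>: "\<phi> \<in> S" for \<phi>
  proof -
    have lin: "linear \<phi>" using S(2)[OF \<phi>] by (rule bounded_linear.linear)
    have "\<phi> R = (\<Sum>(t, I)\<in>p. measure lborel I *\<^sub>R \<phi> (f t))"
      using lin by (simp add: R_def linear_sum linear_scale case_prod_unfold)
    then have "\<bar>\<phi> R - integral {a..b} (\<lambda>t. \<phi> (f t))\<bar> < e / 2"
      using \<gamma>(2)[OF \<phi> p(1) fine(2)[OF \<phi>]] by simp
    moreover have "\<bar>\<phi> (sum x p) - \<phi> R\<bar> \<le> K * (2 * d)"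
      using KS[OF \<phi>, of "sum x p - R"] mult_left_mono[OF near less_imp_le[OF K]] lin
      by (simp add: linear_diff)
    ultimately show ?thesis unfolding d(2) by linarith
  qed
  ultimately show "\<exists>x\<in>\<Phi> {a..b}. \<forall>\<phi>\<in>S. \<bar>\<phi> x - integral {a..b} (\<lambda>t. \<phi> (f t))\<bar> \<le> e" by blast
qed

definition F :: "real set \<Rightarrow> 'a" where
  "F I = (SOME x. x \<in> \<Phi> I \<and> (\<forall>\<phi> :: 'a \<Rightarrow> real. bounded_linear \<phi> \<longrightarrow> \<phi> x = integral I (\<lambda>t. \<phi> (f t))))"

lemma F:
  assumes "I \<in> subintervals"
  shows "F I \<in> \<Phi> I" "bounded_linear (\<phi> :: 'a \<Rightarrow> real) \<Longrightarrow> \<phi> (F I) = integral I (\<lambda>t. \<phi> (f t))"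
proof -
  have "\<exists>x. x \<in> \<Phi> I \<and> (\<forall>\<phi> :: 'a \<Rightarrow> real. bounded_linear \<phi> \<longrightarrow> \<phi> x = integral I (\<lambda>t. \<phi> (f t)))"
    using assms weak_integral_exists by (fastforce simp: subintervals_def)
  then have "F I \<in> \<Phi> I \<and> (\<forall>\<phi> :: 'a \<Rightarrow> real. bounded_linear \<phi> \<longrightarrow> \<phi> (F I) = integral I (\<lambda>t. \<phi> (f t)))"
    unfolding F_def by (rule someI_ex)
  then show "F I \<in> \<Phi> I" "bounded_linear \<phi> \<Longrightarrow> \<phi> (F I) = integral I (\<lambda>t. \<phi> (f t))" by blast+
qed

text \<open>Additivity of \<open>\<Phi>\<close> says nothing about the chosen points; it is the
  integrals of \<open>\<phi> \<circ> f\<close> that add, and they determine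
  \<open>F\<close>.\<close>

lemma F_additive: "additive_interval_function F"
  unfolding additive_interval_function_def
proof (intro ballI impI)
  fix I J assume IJ: "I \<in> subintervals" "J \<in> subintervals" "interior I \<inter> interior J = {}" "I \<union> J \<in> subintervals"
  show "F (I \<union> J) = F I + F J"
  proof (rule functionals_separate)
    fix \<phi> :: "'a \<Rightarrow> real" assume \<phi>: "bounded_linear \<phi>"
    have int: "((\<lambda>t. \<phi> (f t)) has_integral \<phi> (F L)) L" if "L \<in> subintervals" for L
      using that functional_integrable[OF _ _ \<phi>] F(2)[OF that \<phi>]
      by (auto simp: subintervals_def)
    have "convex (I \<inter> J)" using IJ(1,2) by (auto simp: subintervals_def intro!: convex_Int)
    then have "negligible (I \<inter> J)" using IJ(3) by (intro negligible_convex_interior[THEN iffD2]) auto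
    then have "((\<lambda>t. \<phi> (f t)) has_integral (\<phi> (F I) + \<phi> (F J))) (I \<union> J)"
      using int IJ(1,2) by (intro has_integral_Un)
    then have "\<phi> (F (I \<union> J)) = \<phi> (F I) + \<phi> (F J)" using int[OF IJ(4)] by (rule has_integral_unique[rotated])
    then show "\<phi> (F (I \<union> J)) = \<phi> (F I + F J)" using \<phi> by (simp add: bounded_linear.linear linear_add)
  qed
qed

definition defect :: "real \<Rightarrow> real set \<Rightarrow> real" where
  "defect t I = norm (F I - measure lborel I *\<^sub>R f t)"

text \<open>
  Near a density point of a set \<open>A\<close> on which \<open>f\<close> and \<open>\<Gamma>\<close> are almost constant, the nonnegative function
  \<open>gap \<phi>\<close> has almost the full integral \<open>gap \<phi> t * (b - a)\<close>; this bounds \<open>\<phi> (F {a..b})\<close> from above,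
  uniformly in \<open>\<phi>\<close>, and \<open>\<phi>\<close> is then chosen to be norming.
\<close>

lemma defect_rate:
  assumes e: "0 < e" and A: "A \<in> sets lebesgue" "A \<subseteq> {0..1}"
    and osc: "\<And>s t. s \<in> A \<Longrightarrow> t \<in> A \<Longrightarrow> dist (f s) (f t) \<le> e \<and> hclose e (\<Gamma> s) (\<Gamma> t)"
    and t: "t \<in> A" "vanishing_rate_at err t" "vanishing_rate_at (\<lambda>t I. measure lebesgue (I - A)) t"
  shows "rate_le (4 * e) defect t"
proof -
  have t01: "t \<in> {0..1}" using t(1) A(2) by blast
  obtain M where M: "0 < M" "\<And>y. y \<in> \<Gamma> t \<Longrightarrow> norm y \<le> M"
    using Gamma(2)[OF t01] by (auto simp: bounded_pos)
  have "rate_le e err t" using t(2) e by (simp add: vanishing_rate_at_def)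
  then obtain \<eta>1 where \<eta>1: "0 < \<eta>1" "\<And>a b. 0 \<le> a \<and> a \<le> t \<and> t \<le> b \<and> b \<le> 1 \<and> a < b \<and> b - a < \<eta>1 \<Longrightarrow>
      err t {a..b} \<le> e * (b - a)"
    unfolding rate_le_def by blast
  \<comment> \<open>The constant \<open>c\<close> below never exceeds \<open>2 * M\<close>, so the
    part of the interval outside \<open>A\<close> costs at most \<open>e * (b - a)\<close>, whatever
    the functional.\<close>
  have "rate_le (e / (2 * M)) (\<lambda>t I. measure lebesgue (I - A)) t"
    using t(3) e M(1) by (simp add: vanishing_rate_at_def)
  then obtain \<eta>2 where \<eta>2: "0 < \<eta>2" "\<And>a b. 0 \<le> a \<and> a \<le> t \<and> t \<le> b \<and> b \<le> 1 \<and> a < b \<and> b - a < \<eta>2 \<Longrightarrow>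
      measure lebesgue ({a..b} - A) \<le> e / (2 * M) * (b - a)"
    unfolding rate_le_def by blast
  have "defect t {a..b} \<le> 4 * e * (b - a)"
    if ab: "0 \<le> a \<and> a \<le> t \<and> t \<le> b \<and> b \<le> 1 \<and> a < b \<and> b - a < min \<eta>1 \<eta>2" for a b
  proof -
    have sub: "{a..b} \<in> subintervals" using ab by (auto simp: subintervals_def)
    have len: "measure lborel {a..b} = b - a" using ab by simp
    obtain \<phi> where \<phi>: "bounded_linear \<phi>" "\<And>y. \<bar>\<phi> y\<bar> \<le> norm y"
      "\<phi> (F {a..b} - (b - a) *\<^sub>R f t) = norm (F {a..b} - (b - a) *\<^sub>R f t)"
      using norming_functional[of "F {a..b} - (b - a) *\<^sub>R f t"] by blast
    have \<phi>1: "\<bar>\<phi> y\<bar> \<le> 1 * norm y" for y using \<phi>(2) by simp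
    have "\<bar>\<phi> y\<bar> \<le> M" if "y \<in> \<Gamma> t" for y using \<phi>(2)[of y] M(2)[OF that] by simp
    then have gapM: "gap \<phi> t \<le> 2 * M"
      using support_least[OF Gamma(1)[OF t01], of \<phi> M] f_in[OF t01] by (fastforce simp: gap_def abs_le_iff)
    \<comment> \<open>On \<open>A\<close>, \<open>gap \<phi>\<close> drops by at most
      \<open>e\<close> through \<open>\<Gamma>\<close> and \<open>e\<close> through
      \<open>f\<close>; truncation at \<open>0\<close> makes
      \<open>c - c * indicator (- A) s\<close> a lower bound off \<open>A\<close> as well.\<close>
    define c where "c = max 0 (gap \<phi> t - 2 * e)"
    have c: "0 \<le> c" "c \<le> 2 * M" "gap \<phi> t - 2 * e \<le> c" using gapM e M(1) by (auto simp: c_def)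
    have lower: "c - c * indicator (- A) s \<le> gap \<phi> s" if s: "s \<in> {a..b}" for s
    proof (cases "s \<in> A")
      case False
      then show ?thesis using gap_nonneg[OF _ \<phi>(1), of s] s ab by simp
    next
      case True
      have s01: "s \<in> {0..1}" using True A(2) by blast
      have "\<bar>support \<phi> (\<Gamma> s) - support \<phi> (\<Gamma> t)\<bar> \<le> 1 * e"
        using osc[OF True t(1)] Gamma s01 t01 \<phi>(1) \<phi>1 by (intro support_hclose) auto
      moreover have "\<bar>\<phi> (f s) - \<phi> (f t)\<bar> \<le> e"
        using \<phi>(2)[of "f s - f t"] osc[OF True t(1)] \<phi>(1)
        by (simp add: bounded_linear.linear linear_diff dist_norm)
      ultimately have "gap \<phi> t - 2 * e \<le> gap \<phi> s" unfolding gap_def by linarith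
      then show ?thesis using True gap_nonneg[OF s01 \<phi>(1)] by (simp add: c_def)
    qed
    have "((\<lambda>s. c - c * indicator (- A) s) has_integral (c * (b - a) - c * measure lebesgue ({a..b} - A))) {a..b}"
      using has_integral_diff[OF has_integral_const_real[of c a b]
          has_integral_mult_right[OF indicator_Compl_has_integral[OF A(1), of a b], of c]] len
      by (simp add: mult.commute)
    moreover have "(gap \<phi> has_integral (support \<phi> (\<Phi> {a..b}) - \<phi> (F {a..b}))) {a..b}"
      unfolding gap_def F(2)[OF sub \<phi>(1)]
      using ab by (intro has_integral_diff support_Gamma_has_integral integrable_integral functional_integrable \<phi>(1)) auto
    ultimately have "c * (b - a) - c * measure lebesgue ({a..b} - A) \<le> support \<phi> (\<Phi> {a..b}) - \<phi> (F {a..b})"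
      using lower by (rule has_integral_le)
    moreover have "c * measure lebesgue ({a..b} - A) \<le> e * (b - a)"
    proof -
      have "c * measure lebesgue ({a..b} - A) \<le> 2 * M * (e / (2 * M) * (b - a))"
        using \<eta>2(2)[of a b] ab c(1,2) M(1) e by (intro mult_mono) auto
      then show ?thesis using M(1) by simp
    qed
    moreover have "(gap \<phi> t - 2 * e) * (b - a) \<le> c * (b - a)" using c(3) ab by (intro mult_right_mono) auto
    moreover have "\<bar>support \<phi> (\<Phi> {a..b}) - (b - a) * support \<phi> (\<Gamma> t)\<bar> \<le> e * (b - a)"
      using support_err[OF t01 sub _ \<phi>(1) \<phi>1] \<eta>1(2)[of a b] ab len by simp
    \<comment> \<open>Of the \<open>4 * e\<close>, two come from the oscillation on
      \<open>A\<close>, one from the complement of \<open>A\<close>, and one from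
      \<open>err\<close>.\<close>
    ultimately have "\<phi> (F {a..b}) - (b - a) * \<phi> (f t) \<le> 4 * e * (b - a)"
      by (simp add: gap_def algebra_simps abs_le_iff)
    then show ?thesis
      using \<phi>(1,3) len by (simp add: defect_def bounded_linear.linear linear_diff linear_scale)
  qed
  then show ?thesis
    unfolding rate_le_def using \<eta>1(1) \<eta>2(1) by (intro exI[of _ "min \<eta>1 \<eta>2"]) auto
qed

lemma ae_defect_vanishing_rate: "negligible {t \<in> {0..1}. \<not> vanishing_rate_at defect t}"
proof (rule ae_vanishing_rate)
  fix e :: real assume "0 < e"
  then have e: "0 < e / 4" by simp
  obtain \<A> where A: "countable \<A>" "\<And>A. A \<in> \<A> \<Longrightarrow> A \<in> sets lebesgue" "negligible ({0..1} - \<Union>\<A>)"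
    "\<And>A. A \<in> \<A> \<Longrightarrow> A \<subseteq> {0..1}"
    "\<And>A s t. A \<in> \<A> \<Longrightarrow> s \<in> A \<Longrightarrow> t \<in> A \<Longrightarrow> dist (f s) (f t) \<le> e / 4 \<and> hclose (e / 4) (\<Gamma> s) (\<Gamma> t)"
    using osc_cover_conj[OF cover[OF e] osc_cover_Gamma[OF e]] by (rule osc_coverE) blast
  define D where "D A = {t \<in> A \<inter> {0..1}. \<not> vanishing_rate_at (\<lambda>t I. measure lebesgue (I - A)) t}" for A
  have "negligible (\<Union>(D ` \<A>))"
    using A(1,2) ae_density_point unfolding D_def by (intro negligible_countable_Union) auto
  then have "negligible (({0..1} - \<Union>\<A>) \<union> {t \<in> {0..1}. \<not> vanishing_rate_at err t} \<union> \<Union>(D ` \<A>))"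
    by (intro negligible_Un A(3) ae_err_vanishing_rate)
  moreover have "rate_le e defect t"
    if t: "t \<in> {0..1}" "vanishing_rate_at err t" "t \<notin> \<Union>(D ` \<A>)" "t \<in> \<Union>\<A>" for t
  proof -
    obtain B where B: "B \<in> \<A>" "t \<in> B" using t(4) by blast
    then have "vanishing_rate_at (\<lambda>t I. measure lebesgue (I - B)) t" using t(1,3) by (auto simp: D_def)
    then have "rate_le (4 * (e / 4)) defect t"
      using A(2,4,5)[OF B(1)] B(2) t(2) by (intro defect_rate[OF e]) auto
    then show ?thesis by simp
  qed
  then have "{t \<in> {0..1}. \<not> rate_le e defect t} \<subseteq>
      ({0..1} - \<Union>\<A>) \<union> {t \<in> {0..1}. \<not> vanishing_rate_at err t} \<union> \<Union>(D ` \<A>)"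
    by blast
  ultimately show "negligible {t \<in> {0..1}. \<not> rate_le e defect t}" by (rule negligible_subset)
qed

text \<open>Off the null set \<open>N\<close> the vanishing rate controls each term. On
  \<open>N\<close>, \<open>F I\<close> is near a point of \<open>\<Gamma> t\<close> scaled by the
  length of \<open>I\<close>, so the defect is at most \<open>err t I\<close> plus that length times
  the diameter of \<open>\<Gamma> t\<close>. These diameters may be unbounded over \<open>N\<close>,
  but a gauge makes their Riemann sum small.\<close>

lemma defect_null: "variationally_null defect"
  unfolding variationally_null_def
proof (intro allI impI)
  fix e :: real assume e: "0 < e"
  define N where "N = {t \<in> {0..1}. \<not> vanishing_rate_at defect t}"
  define M where "M t = (SUP y\<in>\<Gamma> t. norm y)" for t
  have M: "norm y \<le> M t" if t: "t \<in> {0..1}" "y \<in> \<Gamma> t" for t y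
  proof -
    obtain B where "\<And>z. z \<in> \<Gamma> t \<Longrightarrow> norm z \<le> B" using Gamma(2)[OF t(1)] by (auto simp: bounded_iff)
    then show ?thesis unfolding M_def using t(2) by (intro cSUP_upper bdd_aboveI2)
  qed
  \<comment> \<open>Supported on a null set, \<open>m\<close> has gauge integral \<open>0\<close>
    however wild \<open>M\<close> is there.\<close>
  define m where "m t = (if t \<in> N then M t else 0)" for t
  have "(m has_integral 0) {0..1}"
    by (rule has_integral_negligible[of N]) (use ae_defect_vanishing_rate in \<open>auto simp: N_def m_def\<close>)
  then obtain \<gamma>1 where \<gamma>1: "gauge \<gamma>1" "\<And>p. p tagged_division_of {0..1} \<Longrightarrow> \<gamma>1 fine p \<Longrightarrow>
      norm ((\<Sum>(t, I)\<in>p. measure lborel I *\<^sub>R m t) - 0) < e / 6"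
    unfolding has_integral_real using e by (metis divide_pos_pos zero_less_numeral)
  have "0 < e / 3" using e by simp
  then obtain \<gamma>2 where \<gamma>2: "gauge \<gamma>2" "\<And>a b p. 0 \<le> a \<Longrightarrow> b \<le> 1 \<Longrightarrow> p tagged_division_of {a..b} \<Longrightarrow> \<gamma>2 fine p \<Longrightarrow>
      (\<Sum>(t, I)\<in>p. err t I) < e / 3"
    using err_gauge[of "e / 3"] by blast
  have "\<exists>\<eta>>0. \<forall>a b. 0 \<le> a \<and> a \<le> t \<and> t \<le> b \<and> b \<le> 1 \<and> a < b \<and> b - a < \<eta> \<longrightarrow> defect t {a..b} \<le> e / 3 * (b - a)"
    if "t \<in> {0..1} - N" for t
    using that e unfolding N_def vanishing_rate_at_def rate_le_def[symmetric] by simp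
  then obtain \<eta> where \<eta>: "\<And>t. t \<in> {0..1} - N \<Longrightarrow> 0 < \<eta> t"
    "\<And>t a b. t \<in> {0..1} - N \<Longrightarrow> 0 \<le> a \<and> a \<le> t \<and> t \<le> b \<and> b \<le> 1 \<and> a < b \<and> b - a < \<eta> t \<Longrightarrow>
      defect t {a..b} \<le> e / 3 * (b - a)"
    by metis
  have "\<exists>d>0. ball t d \<subseteq> \<gamma>1 t \<inter> \<gamma>2 t" for t
    using gauge_Int[OF \<gamma>1(1) \<gamma>2(1)] unfolding gauge_def by (meson open_contains_ball)
  then obtain \<delta>0 where \<delta>0: "\<And>t. 0 < \<delta>0 t" "\<And>t. ball t (\<delta>0 t) \<subseteq> \<gamma>1 t \<inter> \<gamma>2 t" by metis
  \<comment> \<open>A fine interval is shorter than \<open>2 * \<delta> t\<close>, hence the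
    half.\<close>
  define \<delta> where "\<delta> t = (if t \<in> {0..1} - N then min (\<delta>0 t) (\<eta> t / 2) else \<delta>0 t)" for t
  have \<delta>: "0 < \<delta> t" "\<delta> t \<le> \<delta>0 t" for t using \<delta>0(1) \<eta>(1) by (auto simp: \<delta>_def)
  have "(\<Sum>(t, I)\<in>p. defect t I) < e" if "fine_perron_partition \<delta> p" for p
  proof -
    have p: "p tagged_division_of {0..1}" "(\<lambda>t. {t - \<delta> t <..< t + \<delta> t}) fine p"
      using that by (auto simp: fine_perron_partition_def)
    have "{t - \<delta> t <..< t + \<delta> t} \<subseteq> \<gamma>1 t \<inter> \<gamma>2 t" for t
      using \<delta>0(2)[of t] \<delta>(2)[of t] by (auto simp: ball_eq_greaterThanLessThan subset_iff)
    then have fine: "\<gamma>1 fine p" "\<gamma>2 fine p" using p(2) by (auto simp: fine_def) blast+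
    note sub = tagged_division_subinterval[OF _ _ p(1), simplified]
    have bound: "defect t I \<le> e / 3 * measure lborel I + (err t I + 2 * (measure lborel I *\<^sub>R m t))"
      if tI: "(t, I) \<in> p" for t I
    proof -
      have t01: "t \<in> {0..1}" and I: "I \<in> subintervals" using sub[OF tI] by auto
      have tin: "t \<in> I" using tagged_division_ofD(2)[OF p(1) tI] .
      obtain a b where ab: "I = {a..b}" "0 \<le> a" "a \<le> b" "b \<le> 1" using I by (auto simp: subintervals_def)
      have m: "0 \<le> m t" using order_trans[OF norm_ge_zero M[OF t01 f_in[OF t01]]] unfolding m_def by simp
      show ?thesis
      \<comment> \<open>The rate bound speaks only of nondegenerate intervals; one-point intervals
        join the first case, where their length is \<open>0\<close>.\<close>
      proof (cases "t \<in> N \<or> a = b")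
        case True
        have "defect t I \<le> err t I + 2 * (measure lborel I * m t)"
        proof (rule field_le_epsilon)
          fix d :: real assume "0 < d"
          then have "hclose (err t I + d) (\<Phi> I) ((*\<^sub>R) (measure lborel I) ` \<Gamma> t)"
            by (intro hclose_err t01 I) simp
          then obtain y where y: "y \<in> \<Gamma> t" "dist (F I) (measure lborel I *\<^sub>R y) < err t I + d"
            using F(1)[OF I] unfolding hclose_def by blast
          have "norm (measure lborel I *\<^sub>R (y - f t)) \<le> measure lborel I * (2 * m t)"
          proof (cases "t \<in> N")
            case True
            have "norm (y - f t) \<le> 2 * m t"
              using M[OF t01 y(1)] M[OF t01 f_in[OF t01]] True norm_triangle_ineq4[of y "f t"]
              by (simp add: m_def)
            then show ?thesis by (simp add: mult_left_mono)
          next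
            case False
            then have "measure lborel I = 0" using \<open>t \<in> N \<or> a = b\<close> ab(1) by simp
            then show ?thesis by simp
          qed
          then show "defect t I \<le> err t I + 2 * (measure lborel I * m t) + d"
            using y(2) norm_triangle_ineq[of "F I - measure lborel I *\<^sub>R y" "measure lborel I *\<^sub>R (y - f t)"]
            by (simp add: defect_def dist_norm scaleR_diff_right)
        qed
        then show ?thesis using e by (simp add: add_increasing)
      next
        case False
        have "I \<subseteq> {t - \<delta> t <..< t + \<delta> t}" using fineD[OF p(2) tI] .
        moreover have "a \<in> I" "b \<in> I" using ab(1,3) by auto
        ultimately have "a \<in> {t - \<delta> t <..< t + \<delta> t}" "b \<in> {t - \<delta> t <..< t + \<delta> t}" by blast+
        then have "b - a < 2 * \<delta> t" by simp
        moreover have "\<delta> t \<le> \<eta> t / 2" using False t01 by (simp add: \<delta>_def)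
        ultimately have "defect t I \<le> e / 3 * (b - a)"
          using \<eta>(2)[of t a b] False t01 ab tin by auto
        then show ?thesis using ab m err_nonneg[OF t01 I] by (simp add: add_increasing2)
      qed
    qed
    have "(\<Sum>(t, I)\<in>p. defect t I) \<le>
        (\<Sum>(t, I)\<in>p. e / 3 * measure lborel I + (err t I + 2 * (measure lborel I *\<^sub>R m t)))"
      using bound by (intro sum_mono) auto
    also have "\<dots> = e / 3 * (\<Sum>(t, I)\<in>p. measure lborel I) + ((\<Sum>(t, I)\<in>p. err t I) +
        2 * (\<Sum>(t, I)\<in>p. measure lborel I *\<^sub>R m t))"
      by (simp add: sum.distrib sum_distrib_left case_prod_unfold)
    also have "(\<Sum>(t, I)\<in>p. measure lborel I) = 1"
      using additive_content_tagged_division[of p 0 "1::real"] p(1) by simp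
    \<comment> \<open>The budget is \<open>e / 3\<close> from the rate, \<open>e / 3\<close> from
      \<open>err\<close>, and twice \<open>e / 6\<close> from \<open>m\<close>.\<close>
    finally show ?thesis
      using \<gamma>1(2)[OF p(1) fine(1)] \<gamma>2(2)[OF _ _ p(1) fine(2)] by (simp add: abs_less_iff)
  qed
  then show "\<exists>\<delta>. (\<forall>t\<in>{0..1}. 0 < \<delta> t) \<and> (\<forall>p. fine_perron_partition \<delta> p \<longrightarrow> (\<Sum>(t, I)\<in>p. defect t I) < e)"
    using \<delta>(1) by blast
qed

lemma selection_vH_integrable: "vH_integrable f"
  unfolding vH_integrable_def
  using F_additive defect_null unfolding variationally_null_def defect_def by blast

end

theorem theorem5p1:
  fixes \<Gamma> :: "real \<Rightarrow> 'a::banach set"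
  assumes "\<forall>t\<in>{0..1}. \<Gamma> t \<in> cwk"
    and "vH_integrable_multi \<Gamma>"
  shows "S_vH \<Gamma> \<noteq> {} \<and> (\<forall>f\<in>selections \<Gamma>. strongly_measurable f \<longrightarrow> vH_integrable f)"
proof -
  obtain \<Phi> where "interval_multimeasure \<Phi>"
    "variationally_null (\<lambda>t I. hausdorff_dist (\<Phi> I) ((*\<^sub>R) (measure lborel I) ` \<Gamma> t))"
    using assms(2) unfolding vH_integrable_multi_def variationally_null_def by blast
  then interpret vH_multifunction \<Gamma> \<Phi>
    using assms(1) by unfold_locales auto
  \<comment> \<open>Small oscillation is the property common to the constructed selection and to the
    strongly measurable ones, so one argument serves both claims.\<close>
  have integrable: "vH_integrable f"
    if "f \<in> selections \<Gamma>" "\<And>e. 0 < e \<Longrightarrow> osc_cover (\<lambda>s t. dist (f s) (f t) \<le> e)" for f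
  proof -
    interpret vH_selection \<Gamma> \<Phi> f using that by unfold_locales
    show ?thesis by (rule selection_vH_integrable)
  qed
  obtain f where "f \<in> selections \<Gamma>" "\<And>e. 0 < e \<Longrightarrow> osc_cover (\<lambda>s t. dist (f s) (f t) \<le> e)"
    using osc_cover_selection[OF cwk osc_cover_Gamma] by blast
  then have "f \<in> S_vH \<Gamma>" using integrable by (simp add: S_vH_def)
  then show ?thesis using integrable strongly_measurable_osc_cover by blast
qed

end
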